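(* Let $\tau\in\mathbb{H}$, $q=e^{2\pi i\tau}$, and let $$G(\bm\zeta):=\frac{1}{\left(\zeta_1q,\zeta_1^{-1}q,\zeta_2q,\zeta_2^{-1}q,\zeta_1\zeta_2q,\zeta_1^{-1}\zeta_2^{-1}q;q\right)_\infty}.$$ In the range $|q| < |\zeta_1|, |\zeta_2|, |\zeta_1 \zeta_2| < 1$ we have $$\mathrm{CT}_{[\bm\zeta]} \left(G(\bm\zeta)\right) = \frac{q^{\frac14} }{\eta(\tau)^6 }\,G_0 (\tau) + \frac{9q^{-\frac{1}{12}}}{\eta(\tau)^6}\, \Psi (\tau)$$ $$= 1 + 3q^2 + 8 q^3 + 21 q^4 + 48 q^5 + 116 q^6+252 q^7 + 555 q^8 + 1156 q^9 + O\left(q^{10}\right).$$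
   Context: $(a;q)_\infty=\prod_{j\ge0}(1-aq^j)$ and $(a_1,\dots,a_\ell;q)_\infty=\prod_j(a_j;q)_\infty$. $\mathrm{CT}_{[\bm\zeta]}$ denotes the constant term in the Laurent expansion in $\zeta_1,\zeta_2$ in the given range. ($G$ is $q^{\frac{8k}{24(k+3)}}(q;q)_\infty^2$ times the character of the universal affine vertex algebra $V_k(\mathfrak{sl}_3)$ at generic level $k$, so its constant term is, up to a power of $q$, the generic parafermion character of type $A_2$.) $\eta(\tau)=q^{1/24}\prod_{n\ge1}(1-q^n)$. $\mathrm{sgn}(x)=x/|x|$ for $x\ne0$, $\mathrm{sgn}(0)=0$. Further $$G_0 (\tau) := 1+3 \sum_{n \in \mathbb{Z}} |n| q^{n^2} - 6 q^{-\frac14} \sum_{n \in \mathbb{Z}+\frac12} |n| q^{n^2},$$ $$\Psi (\tau) := \sum_{\bm n \in\mathbb{Z}^2+\left( \frac13,\frac13 \right) } \mathrm{sgn} (n_1)\, \mathrm{sgn} (n_2)\,n_1\, q^{Q_A (\bm n)},\qquad Q_A(\bm n) := n_1^2+n_1n_2+n_2^2 .$$ *)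

theory Defs
  imports "HOL-Analysis.Analysis" "HOL-Library.Landau_Symbols"
begin

text \<open>The fractional power $q^r$ of $q = e^{2\pi i\tau}$ means $e^{2\pi i r\tau}$; it is a function of
  \<open>\<tau>\<close>, not of \<open>q\<close>.\<close>

definition q_powr :: "complex \<Rightarrow> real \<Rightarrow> complex" where
  "q_powr \<tau> r = exp (2 * of_real pi * \<i> * of_real r * \<tau>)"

definition q_of :: "complex \<Rightarrow> complex" where
  "q_of \<tau> = exp (2 * of_real pi * \<i> * \<tau>)"

definition qpoch :: "complex \<Rightarrow> complex \<Rightarrow> complex" where
  "qpoch a q = (\<Prod>j. 1 - a * q ^ j)"

definition qpochs :: "complex list \<Rightarrow> complex \<Rightarrow> complex" where
  "qpochs as q = prod_list (map (\<lambda>a. qpoch a q) as)"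

definition dedekind_eta :: "complex \<Rightarrow> complex" where
  "dedekind_eta \<tau> = q_powr \<tau> (1/24) * (\<Prod>n. 1 - q_of \<tau> ^ Suc n)"

definition G_fun :: "complex \<Rightarrow> complex \<times> complex \<Rightarrow> complex" where
  "G_fun q = (\<lambda>(\<zeta>1, \<zeta>2). 1 / qpochs
     [\<zeta>1 * q, inverse \<zeta>1 * q, \<zeta>2 * q, inverse \<zeta>2 * q, \<zeta>1 * \<zeta>2 * q, inverse \<zeta>1 * inverse \<zeta>2 * q] q)"

definition zeta_range :: "complex \<Rightarrow> (complex \<times> complex) set" where
  "zeta_range q = {(\<zeta>1, \<zeta>2). norm q < norm \<zeta>1 \<and> norm \<zeta>1 < 1 \<and>
     norm q < norm \<zeta>2 \<and> norm \<zeta>2 < 1 \<and> norm q < norm (\<zeta>1 * \<zeta>2) \<and> norm (\<zeta>1 * \<zeta>2) < 1}"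

definition laurent_expansion_on ::
  "(complex \<times> complex) set \<Rightarrow> (complex \<times> complex \<Rightarrow> complex) \<Rightarrow> (int \<times> int \<Rightarrow> complex) \<Rightarrow> bool" where
  "laurent_expansion_on D f c \<longleftrightarrow>
     (\<forall>(\<zeta>1, \<zeta>2) \<in> D. ((\<lambda>(m, n). c (m, n) * \<zeta>1 powi m * \<zeta>2 powi n) has_sum f (\<zeta>1, \<zeta>2)) UNIV)"

text \<open>Meaningful only when the expansion of \<open>f\<close> on \<open>D\<close> exists and is unique.\<close>

definition constant_term ::
  "(complex \<times> complex) set \<Rightarrow> (complex \<times> complex \<Rightarrow> complex) \<Rightarrow> complex" where
  "constant_term D f = (THE c. laurent_expansion_on D f c) (0, 0)"

definition shifted_int :: "real \<Rightarrow> real set" where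
  "shifted_int a = {of_int k + a | k :: int. True}"

definition G0 :: "complex \<Rightarrow> complex" where
  "G0 \<tau> = 1 + 3 * (\<Sum>\<^sub>\<infinity>n\<in>shifted_int 0. of_real \<bar>n\<bar> * q_powr \<tau> (n\<^sup>2))
     - 6 * q_powr \<tau> (-1/4) * (\<Sum>\<^sub>\<infinity>n\<in>shifted_int (1/2). of_real \<bar>n\<bar> * q_powr \<tau> (n\<^sup>2))"

definition Q_A :: "real \<Rightarrow> real \<Rightarrow> real" where
  "Q_A n1 n2 = n1\<^sup>2 + n1 * n2 + n2\<^sup>2"

definition Psi :: "complex \<Rightarrow> complex" where
  "Psi \<tau> = (\<Sum>\<^sub>\<infinity>(n1, n2)\<in>shifted_int (1/3) \<times> shifted_int (1/3).
     of_real (sgn n1 * sgn n2 * n1) * q_powr \<tau> (Q_A n1 n2))"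

end

theory Submission
  imports Defs
begin

text \<open>Write \<open>(q;q)\<^sup>2 / (zq, q/z; q) = \<Sum> A\<^sub>m z\<^sup>m\<close>. Comparing exponents, the constant term of \<open>G\<close> is
  \<open>\<Sum> A\<^sub>m\<^sup>3 / (q;q)\<^sup>6\<close>. Here \<open>A\<^sub>m = B\<^sub>m - B\<^sub>m\<^sub>-\<^sub>1\<close> for partial theta values \<open>B\<^sub>m\<close> with
  \<open>B\<^sub>m = 1 - q\<^sup>m\<^sup>+\<^sup>1 B\<^sub>m\<^sub>+\<^sub>1\<close> and \<open>B\<^sub>m + B\<^sub>-\<^sub>m\<^sub>-\<^sub>1 = 1\<close>. Iterating the recurrence on both factors gives
  \<open>B\<^sub>m B\<^sub>p\<^sub>-\<^sub>1\<^sub>-\<^sub>m = \<Sum>\<^sub>n q^(n\<^sup>2 + np) (B\<^sub>m\<^sub>+\<^sub>n - B\<^sub>m\<^sub>-\<^sub>n\<^sub>-\<^sub>p)\<close>, whose sum over \<open>m\<close> telescopes to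
  \<open>\<Sum>\<^sub>n (2n + p) q^(n\<^sup>2 + np)\<close>. Using the product formula once to linearise \<open>A\<^sub>m\<^sup>2 = A\<^sub>m A\<^sub>-\<^sub>m\<close> and once
  more for the remaining products turns \<open>\<Sum> A\<^sub>m\<^sup>3\<close> into double series with linear weights, which
  become \<open>G\<^sub>0\<close> and \<open>\<Psi>\<close> after reindexing the four quadrants of the lattice sum.\<close>

subsection \<open>Sums over the integers\<close>

text \<open>\<open>B m\<close> tends to 1 as m goes to infinity and to 0 as m goes to minus
  infinity, so \<open>B\<close> is not summable and its generating series diverges on the unit
  circle. Sums over m are therefore taken only of differences of \<open>B\<close>, of products with
  the decaying \<open>A\<close>, or of products B i * B j whose index sum is fixed. A fixed index
  sum is also what the product formula needs: each step raises both indices by 1, and the reflection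
  then merges the linear terms into a single difference. Reading \<open>A m ^ 2\<close> as
  \<open>A m * A (- m)\<close> is what supplies such products inside the cube.

  The expansion at q = 0 needs separate care. \<open>G0\<close> and \<open>Psi\<close> are written
  with fractional powers, hence through \<tau>, while the numerator \<open>X\<close> is a series in
  q alone. The estimate is proved for \<open>X\<close> and \<open>qpoch q q\<close> as q tends to 0
  and only then composed with \<open>q_of\<close>.\<close>

lemma has_sum_int_split:
  fixes f :: "int \<Rightarrow> 'a :: topological_ab_group_add"
  assumes "((\<lambda>n. f (int n)) has_sum a) UNIV" "((\<lambda>n. f (- int n - 1)) has_sum b) UNIV"
  shows "(f has_sum (a + b)) UNIV"
proof -
  have inj: "inj int" "inj (\<lambda>n. - int n - 1)"
    by (auto simp: inj_def)
  have "(f has_sum a) (range int)" "(f has_sum b) (range (\<lambda>n. - int n - 1))"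
    using assms inj by (auto simp: has_sum_reindex o_def)
  hence "(f has_sum (a + b)) (range int \<union> range (\<lambda>n. - int n - 1))"
    by (intro has_sum_Un_disjoint) auto
  also have "range int \<union> range (\<lambda>n. - int n - 1) = UNIV"
  proof (intro equalityI subsetI UnCI)
    fix x :: int
    assume "x \<notin> range (\<lambda>n. - int n - 1)"
    hence "x \<noteq> - int (nat (- x - 1)) - 1"
      by blast
    hence "x \<ge> 0"
      by (cases "x \<ge> 0") auto
    hence "x = int (nat x)"
      by simp
    thus "x \<in> range int"
      by blast
  qed auto
  finally show ?thesis .
qed

lemma summable_on_int_split:
  fixes f :: "int \<Rightarrow> 'a :: topological_ab_group_add"
  assumes "(\<lambda>n. f (int n)) summable_on UNIV" "(\<lambda>n. f (- int n - 1)) summable_on UNIV"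
  shows "f summable_on UNIV"
  using has_sum_int_split assms unfolding summable_on_def by metis

lemma has_sum_int_shift:
  "((\<lambda>m. f (m + a)) has_sum s) UNIV \<longleftrightarrow> (f has_sum s) (UNIV :: int set)"
  by (rule has_sum_reindex_bij_witness[of _ "\<lambda>m. m - a" "\<lambda>m. m + a"]) auto

lemma has_sum_int_reflect:
  "((\<lambda>m. f (a - m)) has_sum s) UNIV \<longleftrightarrow> (f has_sum s) (UNIV :: int set)"
  by (rule has_sum_reindex_bij_witness[of _ "\<lambda>m. a - m" "\<lambda>m. a - m"]) auto

lemma geometric_summable_on_nat:
  fixes r :: real
  assumes "0 \<le> r" "r < 1"
  shows "(\<lambda>n. r ^ n) summable_on UNIV"
  using assms by (intro summable_nonneg_imp_summable_on) (auto intro: summable_geometric)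

text \<open>The two halves are dominated by geometric series of ratios |z| r and r / |z|. For
  \<open>A\<close> with r = |q| this gives the annulus |q| < |z| < 1/|q|, which contains the point z
  = 1 where a constant is evaluated later.\<close>

lemma Laurent_summable_on_int:
  fixes a :: "int \<Rightarrow> complex"
  assumes a: "\<And>m. norm (a m) \<le> C * r ^ nat \<bar>m\<bar>"
    and "0 < r" "r < norm z" "norm z * r < 1"
  shows "(\<lambda>m. norm (a m * z powi m)) summable_on UNIV"
proof (rule summable_on_int_split)
  have "C \<ge> 0"
    using order_trans[OF norm_ge_zero a[of 0]] by simp
  have z: "norm z > 0"
    using assms by linarith
  have "(\<lambda>n. C * (norm z * r) ^ n) summable_on UNIV"
    using assms by (intro summable_on_cmult_right geometric_summable_on_nat) auto
  thus "(\<lambda>n. norm (a (int n) * z powi int n)) summable_on UNIV"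
  proof (rule summable_on_comparison_test)
    fix n
    show "norm (a (int n) * z powi int n) \<le> C * (norm z * r) ^ n"
      using mult_right_mono[OF a[of "int n"], of "norm z ^ n"]
      by (simp add: norm_mult norm_power power_mult_distrib mult_ac)
  qed auto
  have "(\<lambda>n. C * (r / norm z) * (r / norm z) ^ n) summable_on UNIV"
    using assms z by (intro summable_on_cmult_right geometric_summable_on_nat) auto
  thus "(\<lambda>n. norm (a (- int n - 1) * z powi (- int n - 1))) summable_on UNIV"
  proof (rule summable_on_comparison_test)
    fix n
    have "norm (a (- int n - 1)) \<le> C * r ^ Suc n"
      using a[of "- int n - 1"] by (simp add: nat_add_distrib)
    moreover have "norm (z powi (- int n - 1)) = 1 / norm z ^ Suc n"
    proof -
      have "z powi (- int n - 1) = z powi (- int (Suc n))"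
        by (rule arg_cong) simp
      also have "\<dots> = inverse (z ^ Suc n)"
        by (simp only: power_int_minus power_int_of_nat)
      finally show ?thesis
        by (simp add: norm_inverse norm_mult norm_power divide_inverse)
    qed
    ultimately have "norm (a (- int n - 1) * z powi (- int n - 1)) \<le> C * r ^ Suc n * (1 / norm z ^ Suc n)"
      unfolding norm_mult by (intro mult_mono) (use \<open>C \<ge> 0\<close> assms in auto)
    thus "norm (a (- int n - 1) * z powi (- int n - 1)) \<le> C * (r / norm z) * (r / norm z) ^ n"
      by (simp add: power_divide)
  qed auto
qed

subsection \<open>Partial theta coefficients\<close>

text \<open>A theta series summed over k \<ge> 0 only. Cutting off the negative k is what makes its
  recurrence inhomogeneous, with leading term 1.\<close>

definition partial_theta :: "complex \<Rightarrow> nat \<Rightarrow> complex" where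
  "partial_theta q m = (\<Sum>k. (-1) ^ k * q ^ (k * (k + 1) div 2 + k * m))"

text \<open>\<open>false_theta_coeff q m\<close> is \<open>(q; q)\<^sup>2\<close> times the coefficient of \<open>z\<^sup>m\<close> in
  \<open>1 / (z, q/z; q)\<close> for \<open>\<bar>q\<bar> < \<bar>z\<bar> < 1\<close>; differencing in \<open>m\<close> gives \<open>A\<close>, the coefficients for
  \<open>1 / (zq, q/z; q)\<close>.\<close>

definition false_theta_coeff :: "complex \<Rightarrow> int \<Rightarrow> complex" where
  "false_theta_coeff q m =
     (if m \<ge> 0 then partial_theta q (nat m) else 1 - partial_theta q (nat (- m - 1)))"

text \<open>For \<open>q = 0\<close> the negative powers of \<open>q\<close> in the recurrence would be junk.\<close>

locale nome =
  fixes q :: complex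
  assumes norm_q: "norm q < 1" and q_nz: "q \<noteq> 0"
begin

abbreviation B :: "int \<Rightarrow> complex" where
  "B \<equiv> false_theta_coeff q"

definition A :: "int \<Rightarrow> complex" where
  "A m = B m - B (m - 1)"

lemma norm_q_pos: "norm q > 0"
  using q_nz by simp

lemma partial_theta_term_le: "norm ((-1) ^ k * q ^ (k * (k + 1) div 2 + k * m)) \<le> norm q ^ k"
proof -
  have "k * 2 \<le> k * (k + 1)"
    by (cases k) auto
  hence "k \<le> k * (k + 1) div 2"
    by linarith
  hence "k \<le> k * (k + 1) div 2 + k * m"
    by linarith
  thus ?thesis
    using norm_q by (auto simp: norm_mult norm_power intro!: power_decreasing)
qed

lemma partial_theta_summable: "summable (\<lambda>k. (-1) ^ k * q ^ (k * (k + 1) div 2 + k * m))"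
  by (rule summable_comparison_test'[OF summable_geometric[of "norm q"]])
     (use norm_q partial_theta_term_le in auto)

lemma norm_partial_theta_le: "norm (partial_theta q m) \<le> 1 / (1 - norm q)"
proof -
  have "norm (partial_theta q m) \<le> (\<Sum>k. norm q ^ k)"
    unfolding partial_theta_def
    by (rule norm_suminf_le) (use norm_q partial_theta_term_le summable_geometric[of "norm q"] in auto)
  thus ?thesis
    using norm_q by (simp add: suminf_geometric)
qed

text \<open>The term k = 0 is 1. Shifting k in the rest turns the triangular exponent into m + 1
  plus the exponent of the series at m + 1.\<close>

lemma partial_theta_rec: "partial_theta q m = 1 - (q ^ (m + 1)) * partial_theta q (m + 1)"
proof -
  have "Suc k * (Suc k + 1) div 2 + Suc k * m = (m + 1) + (k * (k + 1) div 2 + k * (m + 1))" for k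
  proof -
    have "Suc k * (Suc k + 1) = k * (k + 1) + 2 * (k + 1)"
      by (simp add: algebra_simps)
    hence "Suc k * (Suc k + 1) div 2 = k * (k + 1) div 2 + (k + 1)"
      by simp
    thus ?thesis
      by (simp add: algebra_simps)
  qed
  hence "(\<Sum>k. (-1) ^ Suc k * q ^ (Suc k * (Suc k + 1) div 2 + Suc k * m)) =
        (\<Sum>k. - (q ^ (m + 1)) * ((-1) ^ k * q ^ (k * (k + 1) div 2 + k * (m + 1))))"
    by (simp only: power_add) (simp add: mult_ac)
  also have "\<dots> = - (q ^ (m + 1)) * partial_theta q (m + 1)"
    unfolding partial_theta_def using partial_theta_summable by (intro suminf_mult)
  finally show ?thesis
    using suminf_split_head[OF partial_theta_summable[of m]]
    by (simp only: partial_theta_def [symmetric] diff_eq_eq) simp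
qed

lemma B_reflect: "B (- m - 1) = 1 - B m"
  by (auto simp: false_theta_coeff_def)

text \<open>The reflection used to define \<open>B\<close> at negative indices is chosen so that the
  recurrence persists there: for m < -1 the claim is \<open>partial_theta_rec\<close> multiplied by
  an inverse power of q, and at m = -1 it is the reflection itself.\<close>

lemma B_rec: "B m = 1 - q powi (m + 1) * B (m + 1)"
proof (cases "m \<ge> 0")
  case True
  then obtain n where "m = int n"
    using nonneg_int_cases by blast
  thus ?thesis
    using partial_theta_rec[of n] by (simp add: false_theta_coeff_def nat_add_distrib power_int_def)
next
  case False
  then obtain n where n: "m = - int n - 1"
    using that[of "nat (- m - 1)"] False by auto
  show ?thesis
  proof (cases n)
    case 0
    thus ?thesis
      using n by (simp add: false_theta_coeff_def)
  next
    case (Suc k)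
    have "m + 1 = - int (k + 1)"
      using n Suc by simp
    hence "q powi (m + 1) = inverse (q ^ (k + 1))"
      by (simp only: power_int_minus power_int_of_nat)
    hence "q powi (m + 1) * q ^ (k + 1) = 1"
      using q_nz by (simp add: field_simps)
    hence "q powi (m + 1) * (1 - partial_theta q k) = partial_theta q (k + 1)"
      by (subst partial_theta_rec) (simp add: mult.assoc [symmetric])
    thus ?thesis
      using n Suc by (simp add: false_theta_coeff_def nat_add_distrib)
  qed
qed

lemma B_bound: "\<exists>C. \<forall>m. norm (B m) \<le> C"
proof (intro exI allI)
  have "norm (1 - partial_theta q n) \<le> 1 + 1 / (1 - norm q)" for n
    using norm_triangle_ineq4[of 1 "partial_theta q n"] norm_partial_theta_le[of n] by simp
  moreover have "norm (partial_theta q n) \<le> 1 + 1 / (1 - norm q)" for n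
    using norm_partial_theta_le[of n] by simp
  ultimately show "norm (B m) \<le> 1 + 1 / (1 - norm q)" for m
    by (simp add: false_theta_coeff_def)
qed

lemma B_tendsto: "(\<lambda>n. B (int n)) \<longlonglongrightarrow> 1"
proof -
  have "(\<lambda>n. q ^ (n + 1) * partial_theta q (n + 1)) \<longlonglongrightarrow> 0"
  proof (rule Lim_null_comparison)
    show "\<forall>\<^sub>F n in sequentially. norm (q ^ (n + 1) * partial_theta q (n + 1)) \<le>
            norm q ^ (n + 1) * (1 / (1 - norm q))"
      unfolding norm_mult norm_power by (intro always_eventually allI mult_left_mono norm_partial_theta_le) auto
    have "(\<lambda>n. norm q ^ Suc n * (1 / (1 - norm q))) \<longlonglongrightarrow> 0 * (1 / (1 - norm q))"
      using norm_q by (intro tendsto_mult tendsto_const LIMSEQ_Suc[OF LIMSEQ_power_zero]) auto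
    thus "(\<lambda>n. norm q ^ (n + 1) * (1 / (1 - norm q))) \<longlonglongrightarrow> 0"
      by simp
  qed
  hence "(\<lambda>n. 1 - q ^ (n + 1) * partial_theta q (n + 1)) \<longlonglongrightarrow> 1 - 0"
    by (intro tendsto_intros)
  thus ?thesis
    by (simp only: partial_theta_rec [symmetric]) (simp add: false_theta_coeff_def)
qed

lemma A_neg [simp]: "A (- m) = A m"
  using B_reflect[of "m - 1"] B_reflect[of m] by (simp add: A_def)

text \<open>In a difference of consecutive values the leading 1 of the recurrence cancels and a
  factor q^n comes out. Negative indices follow from the symmetry of \<open>A\<close>.\<close>

lemma A_bound: obtains C where "\<And>m. norm (A m) \<le> C * norm q ^ nat \<bar>m\<bar>"
proof
  define M where "M = 1 / (1 - norm q)"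
  have M: "norm (partial_theta q n) \<le> M" for n
    unfolding M_def by (rule norm_partial_theta_le)
  hence "M \<ge> 0"
    using norm_ge_zero order_trans by blast
  have nat: "norm (A (int n)) \<le> (1 + 2 * M) * norm q ^ n" for n
  proof (cases n)
    case 0
    have "norm (2 * partial_theta q 0 - 1) \<le> 2 * M + 1"
      using norm_triangle_ineq4[of "2 * partial_theta q 0" 1] M[of 0] by (simp add: norm_mult)
    thus ?thesis
      using 0 by (simp add: A_def false_theta_coeff_def)
  next
    case (Suc k)
    have "A (int n) = partial_theta q (k + 1) - partial_theta q k"
      using Suc by (simp add: A_def false_theta_coeff_def nat_add_distrib)
    also have "\<dots> = q ^ Suc k * (partial_theta q (k + 1) - q * partial_theta q (k + 2))"
      using partial_theta_rec[of k] partial_theta_rec[of "k + 1"] by (simp add: algebra_simps)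
    finally have "norm (A (int n)) = norm (partial_theta q (k + 1) - q * partial_theta q (k + 2)) * norm q ^ n"
      by (simp add: norm_mult norm_power Suc)
    moreover have "norm (partial_theta q (k + 1) - q * partial_theta q (k + 2)) \<le> 1 + 2 * M"
    proof -
      have "norm (q * partial_theta q (k + 2)) \<le> 1 * M"
        unfolding norm_mult using norm_q M by (intro mult_mono) auto
      thus ?thesis
        using M[of "k + 1"] by (intro order_trans[OF norm_triangle_ineq4]) linarith
    qed
    ultimately show ?thesis
      by (simp add: mult_right_mono)
  qed
  show "norm (A m) \<le> (1 + 2 * M) * norm q ^ nat \<bar>m\<bar>" for m
  proof -
    have "A m = A (int (nat \<bar>m\<bar>))"
      by (cases "m \<ge> 0") auto
    thus ?thesis
      using nat[of "nat \<bar>m\<bar>"] by simp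
  qed
qed

lemma A_abs_summable: "(\<lambda>m. norm (A m)) summable_on UNIV"
proof -
  obtain C where "\<And>m. norm (A m) \<le> C * norm q ^ nat \<bar>m\<bar>"
    using A_bound by blast
  from Laurent_summable_on_int[OF this, of 1] show ?thesis
    using norm_q norm_q_pos by simp
qed

text \<open>The sum telescopes to the limit of \<open>B\<close> at infinity minus its limit at minus
  infinity, that is 1 - 0. Absolute summability allows the two half-line totals to be computed as
  limits of partial sums.\<close>

lemma A_has_sum: "(A has_sum 1) UNIV"
proof -
  have summ: "A summable_on UNIV"
    by (rule abs_summable_summable[OF A_abs_summable])
  have abs: "(\<lambda>n. A (int n)) summable_on UNIV" "(\<lambda>n. A (- int n - 1)) summable_on UNIV"
  proof -
    have "A summable_on range int" "A summable_on range (\<lambda>n. - int n - 1)"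
      by (rule summable_on_subset_banach[OF summ]; simp)+
    moreover have "inj int" "inj (\<lambda>n. - int n - 1)"
      by (auto simp: inj_def)
    ultimately show "(\<lambda>n. A (int n)) summable_on UNIV" "(\<lambda>n. A (- int n - 1)) summable_on UNIV"
      by (simp_all add: summable_on_reindex o_def)
  qed
  have pos: "(\<lambda>n. A (int n)) sums (1 - B (- 1))"
  proof -
    have "(\<lambda>n. B (int n - 1)) \<longlonglongrightarrow> 1"
      by (rule LIMSEQ_offset[where k = 1]) (simp add: B_tendsto)
    from telescope_sums[OF this] show ?thesis
      by (simp add: A_def)
  qed
  have neg: "(\<lambda>n. A (- int n - 1)) sums B (- 1)"
  proof -
    have "B (- int n - 1) = 1 - B (int n)" for n
      using B_reflect[of "int n"] by simp
    hence "(\<lambda>n. B (- int n - 1)) \<longlonglongrightarrow> 0"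
      using tendsto_diff[OF tendsto_const B_tendsto, of 1] by simp
    from telescope_sums'[OF this] show ?thesis
      by (simp add: A_def algebra_simps)
  qed
  have "(A has_sum ((1 - B (-1)) + B (-1))) UNIV"
  proof (rule has_sum_int_split)
    show "((\<lambda>n. A (int n)) has_sum (1 - B (- 1))) UNIV"
      using abs(1) pos by (metis has_sum_imp_sums has_sum_infsum sums_unique2)
    show "((\<lambda>n. A (- int n - 1)) has_sum B (- 1)) UNIV"
      using abs(2) neg by (metis has_sum_imp_sums has_sum_infsum sums_unique2)
  qed
  thus ?thesis
    by simp
qed

end

section \<open>Interchange of summation and comparison tests\<close>

lemma has_sum_row_col_iff:
  fixes F :: "'a \<Rightarrow> 'b \<Rightarrow> complex"
  assumes F: "(\<lambda>(x, y). F x y) summable_on UNIV"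
    and rows: "\<And>x. (F x has_sum r x) UNIV" and cols: "\<And>y. ((\<lambda>x. F x y) has_sum c y) UNIV"
  shows "(r has_sum S) UNIV \<longleftrightarrow> (c has_sum S) UNIV"
proof -
  obtain T where T: "((\<lambda>(x, y). F x y) has_sum T) (UNIV \<times> UNIV)"
    using F by (auto simp: summable_on_def)
  have "(r has_sum T) UNIV"
    by (rule has_sum_SigmaD[OF T]) (use rows in auto)
  moreover have "((\<lambda>(y, x). F x y) has_sum T) (UNIV \<times> UNIV)"
    using T by (subst (asm) has_sum_swap) simp
  hence "(c has_sum T) UNIV"
    by (rule has_sum_SigmaD) (use cols in auto)
  ultimately show ?thesis
    by (metis has_sum_unique)
qed

lemma has_sum_diff:
  fixes f g :: "'a \<Rightarrow> complex"
  assumes "(f has_sum a) I" "(g has_sum b) I"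
  shows "((\<lambda>x. f x - g x) has_sum (a - b)) I"
  using has_sum_add[OF assms(1) has_sum_uminusI[OF assms(2)]] by simp

lemma summable_on_product:
  fixes f :: "'a \<Rightarrow> real" and g :: "'b \<Rightarrow> real"
  assumes "f summable_on UNIV" "g summable_on UNIV" "\<And>x. f x \<ge> 0" "\<And>y. g y \<ge> 0"
  shows "(\<lambda>(x, y). f x * g y) summable_on UNIV"
proof -
  have "(\<lambda>(x, y). f x * g y) summable_on (UNIV \<times> UNIV)"
    using assms
    by (intro summable_on_SigmaI[where g = "\<lambda>x. f x * infsum g UNIV"])
       (auto intro!: has_sum_cmult_right summable_on_cmult_left)
  thus ?thesis
    by simp
qed

lemma summable_on_complex_comparison:
  fixes f :: "'a \<Rightarrow> complex"
  assumes "g summable_on I" "\<And>x. x \<in> I \<Longrightarrow> norm (f x) \<le> g x"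
  shows "f summable_on I"
  by (rule abs_summable_summable, rule summable_on_comparison_test[OF assms(1)])
     (use assms(2) in auto)

lemma linear_geometric_summable_on:
  fixes r a b :: real
  assumes "0 \<le> r" "r < 1" "a \<ge> 0" "b \<ge> 0"
  shows "(\<lambda>n. (a * real n + b) * r ^ n) summable_on UNIV"
proof -
  have "summable (\<lambda>n. real (Suc n) * r ^ n)"
    using geometric_deriv_sums[of r] assms by (auto simp: sums_iff)
  hence "summable (\<lambda>n. (a + b) * (real (Suc n) * r ^ n))"
    by (rule summable_mult)
  hence "(\<lambda>n. (a + b) * (real (Suc n) * r ^ n)) summable_on UNIV"
    using assms by (intro summable_nonneg_imp_summable_on) auto
  thus ?thesis
  proof (rule summable_on_comparison_test)
    fix n
    have "a * real n + b \<le> (a + b) * real (Suc n)"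
      using assms by (simp add: algebra_simps)
    thus "(a * real n + b) * r ^ n \<le> (a + b) * (real (Suc n) * r ^ n)"
      using assms by (simp add: mult_right_mono flip: mult.assoc)
  qed (use assms in auto)
qed

subsection \<open>Products of the coefficients\<close>

context nome
begin

lemma norm_q_power_le: "k \<le> e \<Longrightarrow> norm (q ^ e) \<le> norm q ^ k"
  using norm_q by (auto simp: norm_power intro: power_decreasing)

text \<open>Multiply the two recurrences and replace the linear terms
  \<open>q powi (m + 1) * B (m + 1)\<close> by \<open>1 - B m\<close>, likewise for r. The one
  remaining product has both indices raised by 1.\<close>

lemma B_mult_step: "B m * B r = B m + B r - 1 + q powi (m + r + 2) * (B (m + 1) * B (r + 1))"
proof -
  have "q powi (m + r + 2) = q powi (m + 1) * q powi (r + 1)"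
    using q_nz by (subst power_int_add [symmetric]) (auto simp: algebra_simps)
  thus ?thesis
    by (subst (1 2 3 4) B_rec) (simp add: algebra_simps)
qed

text \<open>After n steps the index sum is p - 1 + 2n, so the next step contributes the power p + 1
  + 2n; these odd increments add up to n^2 + np. The reflection turns the linear part B m' + B r' -
  1 into a difference.\<close>

lemma B_mult_partial:
  "B m * B (int p - 1 - m) =
     (\<Sum>n<N. q ^ (n * n + n * p) * (B (m + int n) - B (m - int n - int p)))
     + q ^ (N * N + N * p) * (B (m + int N) * B (int p - 1 - m + int N))"
proof (induction N)
  case (Suc N)
  define m' r' where "m' = m + int N" and "r' = int p - 1 - m + int N"
  have "r' = - (m - int N - int p) - 1"
    by (simp add: r'_def)
  hence r': "B r' = 1 - B (m - int N - int p)"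
    by (simp only: B_reflect)
  have "m' + r' + 2 = int (p + 2 * N + 1)"
    by (simp add: m'_def r'_def)
  hence "B m' * B r' = B m' - B (m - int N - int p) + q ^ (p + 2 * N + 1) * (B (m' + 1) * B (r' + 1))"
    using B_mult_step[of m' r'] r' by (simp only: power_int_of_nat) simp
  moreover have "Suc N * Suc N + Suc N * p = (N * N + N * p) + (p + 2 * N + 1)"
    by (simp add: algebra_simps)
  ultimately show ?case
    unfolding Suc.IH sum.lessThan_Suc m'_def r'_def
    by (simp only: power_add) (simp add: algebra_simps)
qed auto

lemma B_mult_has_sum:
  "((\<lambda>n. q ^ (n * n + n * p) * (B (m + int n) - B (m - int n - int p)))
      has_sum (B m * B (int p - 1 - m))) UNIV"
proof (rule norm_summable_imp_has_sum)
  obtain C where C: "\<And>m. norm (B m) \<le> C"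
    using B_bound by blast
  have C0: "C \<ge> 0"
    using C[of 0] norm_ge_zero order_trans by blast
  have e: "n \<le> n * n + n * p" for n
    by (cases n) auto
  show "summable (\<lambda>n. norm (q ^ (n * n + n * p) * (B (m + int n) - B (m - int n - int p))))"
  proof (rule summable_comparison_test')
    show "summable (\<lambda>n. norm q ^ n * (C + C))"
      using norm_q by (intro summable_mult2 summable_geometric) auto
    show "norm (norm (q ^ (n * n + n * p) * (B (m + int n) - B (m - int n - int p)))) \<le> norm q ^ n * (C + C)" for n
      unfolding norm_mult real_norm_def abs_mult abs_norm_cancel
      by (intro mult_mono norm_q_power_le e order_trans[OF norm_triangle_ineq4] add_mono C) auto
  qed
  have "(\<lambda>N. q ^ (N * N + N * p) * (B (m + int N) * B (int p - 1 - m + int N))) \<longlonglongrightarrow> 0"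
  proof (rule Lim_null_comparison)
    show "\<forall>\<^sub>F N in sequentially. norm (q ^ (N * N + N * p) * (B (m + int N) * B (int p - 1 - m + int N)))
            \<le> norm q ^ N * (C * C)"
      unfolding norm_mult using C0
      by (intro always_eventually allI mult_mono norm_q_power_le e C) auto
    show "(\<lambda>N. norm q ^ N * (C * C)) \<longlonglongrightarrow> 0"
      using norm_q by (intro tendsto_mult_left_zero LIMSEQ_power_zero) auto
  qed
  hence "(\<lambda>N. B m * B (int p - 1 - m) -
            q ^ (N * N + N * p) * (B (m + int N) * B (int p - 1 - m + int N))) \<longlonglongrightarrow>
          B m * B (int p - 1 - m) - 0"
    by (intro tendsto_intros)
  moreover have "B m * B (int p - 1 - m) - q ^ (N * N + N * p) * (B (m + int N) * B (int p - 1 - m + int N)) =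
                   (\<Sum>n<N. q ^ (n * n + n * p) * (B (m + int n) - B (m - int n - int p)))" for N
    using B_mult_partial[of m p N] by simp
  ultimately show "(\<lambda>n. q ^ (n * n + n * p) * (B (m + int n) - B (m - int n - int p))) sums
                      (B m * B (int p - 1 - m))"
    by (simp add: sums_def)
qed

text \<open>The difference is a sum of a shifted copies of \<open>A\<close>, each of total
  1.\<close>

lemma B_diff_has_sum: "((\<lambda>m. B (m + int a) - B m) has_sum of_nat a) UNIV"
proof (induction a)
  case (Suc a)
  have "((\<lambda>m. A (m + int (Suc a))) has_sum 1) UNIV"
    using A_has_sum by (subst has_sum_int_shift)
  from has_sum_add[OF Suc this] show ?case
    by (simp add: A_def algebra_simps)
qed auto

text \<open>The same decomposition for absolute values. A majorant whose total is linear in a is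
  wanted, since a will be 2n + p and the totals must then be summed against |q|^n.\<close>

lemma norm_B_diff_summable:
  obtains M where "M \<ge> 0"
    "\<And>a. \<exists>F. (F has_sum (real a * M)) UNIV \<and> (\<forall>m. norm (B (m + int a) - B m) \<le> F m)"
proof -
  obtain M where M: "((\<lambda>m. norm (A m)) has_sum M) UNIV"
    using A_abs_summable by (auto simp: summable_on_def)
  have "\<exists>F. (F has_sum (real a * M)) UNIV \<and> (\<forall>m. norm (B (m + int a) - B m) \<le> F m)" for a
  proof (induction a)
    case 0
    thus ?case
      by (intro exI[of _ "\<lambda>_. 0"]) auto
  next
    case (Suc a)
    then obtain F where F: "(F has_sum (real a * M)) UNIV" "\<And>m. norm (B (m + int a) - B m) \<le> F m"
      by blast
    have "((\<lambda>m. norm (A (m + int (Suc a)))) has_sum M) UNIV"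
      using M by (subst has_sum_int_shift[of "\<lambda>m. norm (A m)"])
    from has_sum_add[OF F(1) this]
    have "((\<lambda>m. F m + norm (A (m + int (Suc a)))) has_sum (real (Suc a) * M)) UNIV"
      by (simp add: algebra_simps)
    moreover have "norm (B (m + int (Suc a)) - B m) \<le> F m + norm (A (m + int (Suc a)))" for m
    proof -
      have "B (m + int (Suc a)) - B m = (B (m + int a) - B m) + A (m + int (Suc a))"
        by (simp add: A_def algebra_simps)
      thus ?thesis
        using F(2)[of m] by (simp only:) (intro order_trans[OF norm_triangle_ineq] add_right_mono)
    qed
    ultimately show ?case
      by blast
  qed
  moreover have "M \<ge> 0"
    using M by (rule has_sum_nonneg) auto
  ultimately show thesis
    using that by blast
qed

text \<open>The total of \<open>B m * B (int p - 1 - m)\<close> over all m, see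
  \<open>B_convolution_has_sum\<close>. The factor 2n + p is the distance between the indices m + n
  and m - n - p of the telescoping difference.\<close>

definition g :: "nat \<Rightarrow> complex" where
  "g p = (\<Sum>\<^sub>\<infinity>n. q ^ (n * n + n * p) * of_nat (2 * n + p))"

lemma g_has_sum: "((\<lambda>n. q ^ (n * n + n * p) * of_nat (2 * n + p)) has_sum g p) UNIV"
  unfolding g_def
proof (rule has_sum_infsum, rule summable_on_complex_comparison)
  show "(\<lambda>n. (2 * real n + real p) * norm q ^ n) summable_on UNIV"
    using norm_q by (intro linear_geometric_summable_on) auto
  fix n
  have "norm (q ^ (n * n + n * p)) \<le> norm q ^ n"
    by (rule norm_q_power_le) (cases n, auto)
  moreover have "norm (of_nat (2 * n + p) :: complex) = 2 * real n + real p"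
    by (subst norm_of_nat) simp
  ultimately show "norm (q ^ (n * n + n * p) * of_nat (2 * n + p)) \<le> (2 * real n + real p) * norm q ^ n"
    unfolding norm_mult by (subst mult.commute) (simp only:, intro mult_left_mono, auto)
qed

lemma B_convolution_has_sum: "((\<lambda>m. B m * B (int p - 1 - m)) has_sum g p) UNIV"
proof -
  define F where "F m n = q ^ (n * n + n * p) * (B (m + int n) - B (m - int n - int p))" for m n
  obtain M where M: "M \<ge> 0"
    "\<And>a. \<exists>F. (F has_sum (real a * M)) UNIV \<and> (\<forall>m. norm (B (m + int a) - B m) \<le> F m)"
    using norm_B_diff_summable by blast
  from M(2) obtain H where H: "\<And>a. (H a has_sum (real a * M)) UNIV"
     "\<And>a m. norm (B (m + int a) - B m) \<le> H a m"
    by metis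
  have H0: "H a m \<ge> 0" for a m
    using H(2)[of m a] norm_ge_zero order_trans by blast
  have shift: "B (m + int n) - B (m - int n - int p) =
                 B ((m + (- int n - int p)) + int (2 * n + p)) - B (m + (- int n - int p))" for m n
    by (simp add: algebra_simps)
  \<comment> \<open>Majorant that justifies summing over m first: for fixed n its total is |q|^n (2n
    + p) M.\<close>
  have "(\<lambda>(n, m). norm q ^ n * H (2 * n + p) (m + (- int n - int p))) summable_on UNIV \<times> UNIV"
  proof (rule summable_on_SigmaI)
    fix n :: nat
    show "((\<lambda>m. case (n, m) of (n, m) \<Rightarrow> norm q ^ n * H (2 * n + p) (m + (- int n - int p))) has_sum
             norm q ^ n * (real (2 * n + p) * M)) UNIV"
      using H(1)[of "2 * n + p"] unfolding prod.case
      by (intro has_sum_cmult_right) (subst has_sum_int_shift, simp)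
    have "(\<lambda>n. ((2 * M) * real n + real p * M) * norm q ^ n) summable_on UNIV"
      using norm_q M by (intro linear_geometric_summable_on) auto
    thus "(\<lambda>n. norm q ^ n * (real (2 * n + p) * M)) summable_on UNIV"
      by (rule summable_on_cong[THEN iffD1, rotated]) (auto simp: algebra_simps)
  qed (use H0 in auto)
  hence "(\<lambda>(m, n). norm q ^ n * H (2 * n + p) (m + (- int n - int p))) summable_on UNIV \<times> UNIV"
    by (subst (asm) summable_on_swap) simp
  hence "(\<lambda>(m, n). F m n) summable_on UNIV \<times> UNIV"
  proof (rule summable_on_complex_comparison, safe)
    fix m :: int and n :: nat
    have "n \<le> n * n + n * p"
      by (cases n) auto
    thus "norm (F m n) \<le> norm q ^ n * H (2 * n + p) (m + (- int n - int p))"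
      unfolding F_def norm_mult shift by (intro mult_mono norm_q_power_le H) auto
  qed
  hence summ: "(\<lambda>(m, n). F m n) summable_on UNIV"
    by simp
  have "((\<lambda>m. F m n) has_sum q ^ (n * n + n * p) * of_nat (2 * n + p)) UNIV" for n
    unfolding F_def shift
    by (intro has_sum_cmult_right) (subst has_sum_int_shift, rule B_diff_has_sum)
  from has_sum_row_col_iff[OF summ B_mult_has_sum[where p = p, folded F_def] this] show ?thesis
    using g_has_sum by blast
qed

definition h :: "nat \<Rightarrow> complex" where
  "h n = g (n + 1) - g n"

text \<open>By symmetry A m = B (-m) - B (-m - 1), so each summand splits into products with index
  sums n and n - 1, the cases p = n + 1 and p = n of the convolution.\<close>

lemma A_B_has_sum: "((\<lambda>m. A m * B (m + int n)) has_sum h n) UNIV"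
proof -
  have "((\<lambda>m. B (m + int n) * B (int (n + 1) - 1 - (m + int n))) has_sum g (n + 1)) UNIV"
       "((\<lambda>m. B (m + int n) * B (int n - 1 - (m + int n))) has_sum g n) UNIV"
    using has_sum_int_shift[of "\<lambda>m. B m * B (int (n + 1) - 1 - m)" "int n" "g (n + 1)"]
      has_sum_int_shift[of "\<lambda>m. B m * B (int n - 1 - m)" "int n" "g n"] B_convolution_has_sum
    by blast+
  from has_sum_diff[OF this]
  have "((\<lambda>m. B (m + int n) * B (- m) - B (m + int n) * B (- m - 1)) has_sum h n) UNIV"
    by (simp add: h_def algebra_simps)
  moreover have "B (m + int n) * B (- m) - B (m + int n) * B (- m - 1) = A m * B (m + int n)" for m
    by (subst A_neg [symmetric]) (simp add: A_def algebra_simps)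
  ultimately show ?thesis
    by simp
qed

text \<open>The substitution m -> -m and the reflection replace B (m - n - 1) by 1 - B (m + n),
  which reduces negative offsets to the natural ones covered by \<open>h\<close>.\<close>

lemma A_B_has_sum': "((\<lambda>m. A m * B (m - int n - 1)) has_sum (1 - h n)) UNIV"
proof -
  have "((\<lambda>m. A m - A m * B (m + int n)) has_sum (1 - h n)) UNIV"
    by (intro has_sum_diff A_has_sum A_B_has_sum)
  moreover have "A m - A m * B (m + int n) = A (0 - m) * B ((0 - m) - int n - 1)" for m
  proof -
    have "(0 - m) - int n - 1 = - (m + int n) - 1"
      by simp
    hence "B ((0 - m) - int n - 1) = 1 - B (m + int n)"
      by (simp only: B_reflect)
    thus ?thesis
      by (simp only: right_diff_distrib) simp
  qed
  ultimately have "((\<lambda>m. A (0 - m) * B ((0 - m) - int n - 1)) has_sum (1 - h n)) UNIV"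
    by simp
  thus ?thesis
    by (subst (asm) has_sum_int_reflect[of "\<lambda>m. A m * B (m - int n - 1)"])
qed

lemma A_sq_has_sum: "((\<lambda>m. A m ^ 2) has_sum (2 * h 0 - 1)) UNIV"
  using has_sum_diff[OF A_B_has_sum[of 0] A_B_has_sum'[of 0]]
  by (simp add: A_def power2_eq_square algebra_simps)

text \<open>The \<open>n\<close>-th term of the series for \<open>\<Sum>m. A m * (A m ^ 2 + A m)\<close> obtained by expanding
  \<open>A m ^ 2 = A m * A (- m)\<close> with the product formula and summing over \<open>m\<close> first.\<close>

definition T_term :: "nat \<Rightarrow> complex" where
  "T_term n = 2 * q ^ (n * n + n) * (2 * h n - 1) -
     (if n = 0 then 0 else q ^ (n * n) * (2 * (h n + h (n - 1) - 1)))"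

text \<open>In A m * A (-m) the product B (m - 1) * B (-m - 1) has index sum -2, outside the range p
  \<ge> 0 of the product formula. \<open>B_mult_step\<close>, whose power is q^0 here, trades it for
  B m * B (-m) - A m. This explains the factor 2 in F and the additional \<open>A m ^ 2\<close>.
  Rows of F are product expansions; columns are combinations of the offset sums of A m * B (m +
  i).\<close>

lemma A_cube_has_sum_iff:
  "((\<lambda>m. A m ^ 3 + A m ^ 2) has_sum S) UNIV \<longleftrightarrow> (T_term has_sum S) UNIV"
proof (rule has_sum_row_col_iff)
  define F where "F m n = A m * (2 * (q ^ (n * n + n * 1) * (B (m + int n) - B (m - int n - int 1))) -
      (q ^ (n * n + n * 0) * (B (m + int n) - B (m - int n - int 0)) +
       q ^ (n * n + n * 0) * (B (m - 1 + int n) - B (m - 1 - int n - int 0))))" for m n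
  obtain C where C: "\<And>m. norm (B m) \<le> C"
    using B_bound by blast
  have C0: "C \<ge> 0"
    using C[of 0] norm_ge_zero order_trans by blast
  have "(\<lambda>(m, n). (norm (A m) * (8 * C)) * norm q ^ n) summable_on UNIV"
    using A_abs_summable norm_q C0
    by (intro summable_on_product summable_on_cmult_left geometric_summable_on_nat) auto
  thus "(\<lambda>(m, n). F m n) summable_on UNIV"
  proof (rule summable_on_complex_comparison, safe)
    fix m :: int and n :: nat
    have term_le: "norm (q ^ (n * n + n * p) * (B i - B j)) \<le> norm q ^ n * (C + C)" for p i j
      unfolding norm_mult
      by (intro mult_mono norm_q_power_le order_trans[OF norm_triangle_ineq4] add_mono C) (cases n, auto)
    have "norm (F m n) \<le> norm (A m) * (2 * (norm q ^ n * (C + C)) +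
             (norm q ^ n * (C + C) + norm q ^ n * (C + C)))"
      unfolding F_def norm_mult[of "A m"]
      by (intro mult_left_mono order_trans[OF norm_triangle_ineq4] order_trans[OF norm_triangle_ineq] 
            add_mono term_le) (simp_all only: norm_mult[of 2] norm_numeral term_le mult_left_mono norm_ge_zero zero_le_numeral)
    thus "norm (F m n) \<le> norm (A m) * (8 * C) * norm q ^ n"
      by (simp add: algebra_simps)
  qed
  show "(F m has_sum (A m ^ 3 + A m ^ 2)) UNIV" for m
  proof -
    have "(F m has_sum (A m * (2 * (B m * B (int 1 - 1 - m)) -
            (B m * B (int 0 - 1 - m) + B (m - 1) * B (int 0 - 1 - (m - 1)))))) UNIV"
      unfolding F_def
      by (intro has_sum_cmult_right has_sum_diff has_sum_add B_mult_has_sum)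
    also have "A m * (2 * (B m * B (int 1 - 1 - m)) -
            (B m * B (int 0 - 1 - m) + B (m - 1) * B (int 0 - 1 - (m - 1)))) = A m ^ 3 + A m ^ 2"
    proof -
      have "2 * (B m * B (- m)) - (B m * B (- m - 1) + B (m - 1) * B (- m)) = A m * A (- m) + A m"
      proof -
        have "A m * A (- m) = B m * B (- m) - B m * B (- m - 1) - B (m - 1) * B (- m) + B (m - 1) * B (- m - 1)"
          unfolding A_def by (simp add: algebra_simps)
        moreover have "B (m - 1) * B (- m - 1) = B (m - 1) + B (- m - 1) - 1 + B m * B (- m)"
          using B_mult_step[of "m - 1" "- m - 1"] by simp
        moreover have "A m = 1 - B (- m - 1) - B (m - 1)"
          by (simp only: A_def B_reflect) simp
        ultimately show ?thesis
          by simp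
      qed
      moreover have "int 1 - 1 - m = - m" "int 0 - 1 - m = - m - 1" "int 0 - 1 - (m - 1) = - m"
        by simp_all
      ultimately show ?thesis
        by (simp only: A_neg) (simp add: algebra_simps power2_eq_square power3_eq_cube)
    qed
    finally show ?thesis .
  qed
  show "((\<lambda>m. F m n) has_sum T_term n) UNIV" for n
  proof (cases n)
    \<comment> \<open>For n = 0 both differences with p = 0 vanish identically, hence the case
      distinction in \<open>T_term\<close>.\<close>
    case 0
    have "((\<lambda>m. 2 * (A m * B (m + int 0) - A m * B (m - int 0 - 1))) has_sum (2 * (h 0 - (1 - h 0)))) UNIV"
      by (intro has_sum_cmult_right has_sum_diff A_B_has_sum A_B_has_sum')
    thus ?thesis
      by (simp add: 0 T_term_def F_def algebra_simps)
  next
    \<comment> \<open>The indices m - n and m - 1 + n are m - k - 1 and m + k, which brings in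
      \<open>h k\<close> beside \<open>h n\<close>.\<close>
    case (Suc k)
    have "((\<lambda>m. 2 * q ^ (n * n + n) * (A m * B (m + int n) - A m * B (m - int n - 1)) -
             q ^ (n * n) * ((A m * B (m + int n) - A m * B (m - int k - 1)) +
                            (A m * B (m + int k) - A m * B (m - int n - 1)))) has_sum
           (2 * q ^ (n * n + n) * (h n - (1 - h n)) -
             q ^ (n * n) * ((h n - (1 - h k)) + (h k - (1 - h n))))) UNIV"
      by (intro has_sum_cmult_right has_sum_diff has_sum_add A_B_has_sum A_B_has_sum')
    thus ?thesis
      by (rule has_sum_cong[THEN iffD1, rotated, OF back_subst[of "\<lambda>s. (_ has_sum s) _"]])
         (auto simp: Suc T_term_def F_def algebra_simps)
  qed
qed

end

subsection \<open>Reduction to double series\<close>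

lemma has_sum_Suc_iff:
  fixes f :: "nat \<Rightarrow> complex"
  shows "((\<lambda>n. f (Suc n)) has_sum s) UNIV \<longleftrightarrow> (f has_sum (f 0 + s)) UNIV"
proof -
  have "((\<lambda>n. f (Suc n)) has_sum s) UNIV \<longleftrightarrow> (f has_sum s) (range Suc)"
    by (subst has_sum_reindex) (auto simp: o_def)
  also have "\<dots> \<longleftrightarrow> (f has_sum (f 0 + s)) (insert 0 (range Suc))"
  proof
    assume "(f has_sum (f 0 + s)) (insert 0 (range Suc))"
    moreover have "(f has_sum f 0) {0}"
      by (rule has_sum_finiteI) auto
    ultimately have "(f has_sum (f 0 + s - f 0)) (insert 0 (range Suc) - {0})"
      by (intro has_sum_Diff) auto
    moreover have "insert 0 (range Suc) - {0} = range Suc"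
      by auto
    ultimately show "(f has_sum s) (range Suc)"
      by simp
  qed (auto intro: has_sum_insert)
  also have "insert 0 (range Suc) = UNIV"
    by (metis UNIV_nat_eq)
  finally show ?thesis .
qed

text \<open>By symmetry of u the weights n and k have the same total, so only a + b matters. Every
  linearly weighted lattice sum is thus expressed by two numbers.\<close>

lemma symmetric_weight_has_sum:
  fixes u :: "nat \<Rightarrow> nat \<Rightarrow> complex" and r :: real
  assumes r: "0 \<le> r" "r < 1" and u: "\<And>n k. norm (u n k) \<le> r ^ n * r ^ k"
    and sym: "\<And>n k. u n k = u k n"
  shows "((\<lambda>(n, k). (a * of_nat n + b * of_nat k + c) * u n k) has_sum
            ((a + b) * (\<Sum>\<^sub>\<infinity>(n, k). of_nat n * u n k) + c * (\<Sum>\<^sub>\<infinity>(n, k). u n k))) UNIV"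
proof -
  have 1: "(\<lambda>n. real n * r ^ n) summable_on UNIV" and 0: "(\<lambda>n. r ^ n) summable_on UNIV"
    using linear_geometric_summable_on[of r 1 0] linear_geometric_summable_on[of r 0 1] r by auto
  have s0: "(\<lambda>(n, k). u n k) summable_on UNIV"
    using summable_on_product[OF 0 0] r u by (rule_tac summable_on_complex_comparison) auto
  have "(\<lambda>(n, k). real n * r ^ n * r ^ k) summable_on UNIV"
    using r by (intro summable_on_product 1 0) auto
  hence s1: "(\<lambda>(n, k). of_nat n * u n k) summable_on UNIV"
    by (rule summable_on_complex_comparison)
       (auto simp: norm_mult mult.assoc intro!: mult_left_mono u)
  define U0 U1 where "U0 = (\<Sum>\<^sub>\<infinity>(n, k). u n k)" and "U1 = (\<Sum>\<^sub>\<infinity>(n, k). of_nat n * u n k)"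
  have U0: "((\<lambda>(n, k). u n k) has_sum U0) UNIV" and U1: "((\<lambda>(n, k). of_nat n * u n k) has_sum U1) UNIV"
    using s0 s1 by (auto simp: U0_def U1_def)
  have "((\<lambda>(n, k). of_nat n * u n k) has_sum U1) (UNIV \<times> UNIV)"
    using U1 by simp
  hence "((\<lambda>(n, k). of_nat k * u k n) has_sum U1) (UNIV \<times> UNIV)"
    by (subst (asm) has_sum_swap) simp
  hence U1': "((\<lambda>(n, k). of_nat k * u n k) has_sum U1) UNIV"
    by (subst (asm) sym) simp
  have "((\<lambda>x. a * (case x of (n, k) \<Rightarrow> of_nat n * u n k) + b * (case x of (n, k) \<Rightarrow> of_nat k * u n k)
            + c * (case x of (n, k) \<Rightarrow> u n k)) has_sum (a * U1 + b * U1 + c * U0)) UNIV"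
    by (intro has_sum_add has_sum_cmult_right U0 U1 U1')
  thus ?thesis
    unfolding U0_def [symmetric] U1_def [symmetric]
    by (simp add: case_prod_unfold algebra_simps)
qed

context nome
begin

text \<open>The exponents of \<open>e\<close> and \<open>f\<close> are \<open>Q_A\<close> at (n +
  1/3, k + 1/3) and at (n + 2/3, k + 2/3), each minus 1/3; this is the link with
  \<open>Psi\<close>.\<close>

definition e :: "nat \<Rightarrow> nat \<Rightarrow> complex" where
  "e n k = q ^ (n * n + n * k + k * k + n + k)"

definition f :: "nat \<Rightarrow> nat \<Rightarrow> complex" where
  "f n k = q ^ (n * n + n * k + k * k + 2 * n + 2 * k + 1)"

definition E0 :: complex where "E0 = (\<Sum>\<^sub>\<infinity>(n, k). e n k)"
definition E1 :: complex where "E1 = (\<Sum>\<^sub>\<infinity>(n, k). of_nat n * e n k)"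
definition F0 :: complex where "F0 = (\<Sum>\<^sub>\<infinity>(n, k). f n k)"
definition F1 :: complex where "F1 = (\<Sum>\<^sub>\<infinity>(n, k). of_nat n * f n k)"
definition P0 :: complex where "P0 = (\<Sum>\<^sub>\<infinity>n. q ^ (n * n + n))"
definition P1 :: complex where "P1 = (\<Sum>\<^sub>\<infinity>n. of_nat n * q ^ (n * n + n))"
definition R0 :: complex where "R0 = (\<Sum>\<^sub>\<infinity>n. q ^ (Suc n * Suc n))"
definition R1 :: complex where "R1 = (\<Sum>\<^sub>\<infinity>n. of_nat n * q ^ (Suc n * Suc n))"

lemma e_has_sum:
  "((\<lambda>(n, k). (a * of_nat n + b * of_nat k + c) * e n k) has_sum ((a + b) * E1 + c * E0)) UNIV"
  unfolding E0_def E1_def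
proof (rule symmetric_weight_has_sum)
  show "norm (e n k) \<le> norm q ^ n * norm q ^ k" for n k
    unfolding e_def power_add [symmetric] by (rule norm_q_power_le) simp
qed (use norm_q in \<open>auto simp: e_def algebra_simps\<close>)

lemma f_has_sum:
  "((\<lambda>(n, k). (a * of_nat n + b * of_nat k + c) * f n k) has_sum ((a + b) * F1 + c * F0)) UNIV"
  unfolding F0_def F1_def
proof (rule symmetric_weight_has_sum)
  show "norm (f n k) \<le> norm q ^ n * norm q ^ k" for n k
    unfolding f_def power_add [symmetric] by (rule norm_q_power_le) simp
qed (use norm_q in \<open>auto simp: f_def algebra_simps\<close>)

lemma weight_has_sum:
  assumes "\<And>n. n \<le> d n"
  shows "((\<lambda>n. (a * of_nat n + b) * q ^ d n) has_sum
           (a * (\<Sum>\<^sub>\<infinity>n. of_nat n * q ^ d n) + b * (\<Sum>\<^sub>\<infinity>n. q ^ d n))) UNIV"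
proof -
  have "(\<lambda>n. q ^ d n) summable_on UNIV"
    using norm_q by (rule_tac summable_on_complex_comparison[OF geometric_summable_on_nat[of "norm q"]])
      (auto intro: norm_q_power_le assms)
  moreover have "(\<lambda>n. (1 * real n + 0) * norm q ^ n) summable_on UNIV"
    using norm_q by (intro linear_geometric_summable_on) auto
  hence "(\<lambda>n. of_nat n * q ^ d n) summable_on UNIV"
    by (rule summable_on_complex_comparison)
       (auto simp: norm_mult simp del: norm_power intro!: mult_left_mono norm_q_power_le assms)
  ultimately have "((\<lambda>n. a * (of_nat n * q ^ d n) + b * q ^ d n) has_sum
           (a * (\<Sum>\<^sub>\<infinity>n. of_nat n * q ^ d n) + b * (\<Sum>\<^sub>\<infinity>n. q ^ d n))) UNIV"
    by (intro has_sum_add has_sum_cmult_right has_sum_infsum)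
  thus ?thesis
    by (simp add: algebra_simps)
qed

lemma P_has_sum: "((\<lambda>n. (a * of_nat n + b) * q ^ (n * n + n)) has_sum (a * P1 + b * P0)) UNIV"
  unfolding P0_def P1_def by (rule weight_has_sum) simp

lemma R_has_sum: "((\<lambda>n. (a * of_nat n + b) * q ^ (Suc n * Suc n)) has_sum (a * R1 + b * R0)) UNIV"
  unfolding R0_def R1_def by (rule weight_has_sum) simp

text \<open>The term n = 0 is split off and n shifted. Its purpose is to repair symmetry: q^(n^2 +
  n) * g n has the exponent n^2 + n + k^2 + kn, not symmetric in n and k, and is rewritten through g
  (n + 2).\<close>

lemma g_rec: "g p = of_nat p + q ^ (p + 1) * g (p + 2)"
proof -
  have "Suc n * Suc n + Suc n * p = (p + 1) + (n * n + n * (p + 2))" for n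
    by (simp add: algebra_simps)
  hence *: "q ^ (Suc n * Suc n + Suc n * p) * of_nat (2 * Suc n + p) =
          q ^ (p + 1) * (q ^ (n * n + n * (p + 2)) * of_nat (2 * n + (p + 2)))" for n
    by (simp only: power_add) (simp add: algebra_simps)
  have "((\<lambda>n. q ^ (Suc n * Suc n + Suc n * p) * of_nat (2 * Suc n + p)) has_sum
          q ^ (p + 1) * g (p + 2)) UNIV"
    unfolding * by (intro has_sum_cmult_right g_has_sum)
  from has_sum_Suc_iff[THEN iffD1, OF this] show ?thesis
    using has_sum_unique[OF g_has_sum[of p]] by simp
qed

lemma g_odd_has_sum: "((\<lambda>n. q ^ (n * n + n) * g (n + 1)) has_sum (3 * E1 + E0)) UNIV"
proof -
  have "((\<lambda>(n, k). (1 * of_nat n + 2 * of_nat k + 1) * e n k) has_sum ((1 + 2) * E1 + 1 * E0)) (UNIV \<times> UNIV)"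
    unfolding UNIV_Times_UNIV by (rule e_has_sum)
  hence "((\<lambda>n. q ^ (n * n + n) * g (n + 1)) has_sum ((1 + 2) * E1 + 1 * E0)) UNIV"
  proof (rule has_sum_SigmaD)
    fix n
    have "((\<lambda>k. q ^ (n * n + n) * (q ^ (k * k + k * (n + 1)) * of_nat (2 * k + (n + 1))))
            has_sum q ^ (n * n + n) * g (n + 1)) UNIV"
      by (intro has_sum_cmult_right g_has_sum)
    moreover have "q ^ (n * n + n) * (q ^ (k * k + k * (n + 1)) * of_nat (2 * k + (n + 1))) =
                     (1 * of_nat n + 2 * of_nat k + 1) * e n k" for k
      unfolding e_def mult.assoc [symmetric] power_add [symmetric] by (simp add: algebra_simps)
    ultimately show "((\<lambda>k. case (n, k) of (n, k) \<Rightarrow> (1 * of_nat n + 2 * of_nat k + 1) * e n k)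
            has_sum q ^ (n * n + n) * g (n + 1)) UNIV"
      by simp
  qed
  thus ?thesis
    by simp
qed

lemma g_even_has_sum: "((\<lambda>n. q ^ (Suc n * Suc n) * g (n + 2)) has_sum (3 * F1 + 2 * F0)) UNIV"
proof -
  have "((\<lambda>(n, k). (1 * of_nat n + 2 * of_nat k + 2) * f n k) has_sum ((1 + 2) * F1 + 2 * F0)) (UNIV \<times> UNIV)"
    unfolding UNIV_Times_UNIV by (rule f_has_sum)
  hence "((\<lambda>n. q ^ (Suc n * Suc n) * g (n + 2)) has_sum ((1 + 2) * F1 + 2 * F0)) UNIV"
  proof (rule has_sum_SigmaD)
    fix n
    have "((\<lambda>k. q ^ (Suc n * Suc n) * (q ^ (k * k + k * (n + 2)) * of_nat (2 * k + (n + 2))))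
            has_sum q ^ (Suc n * Suc n) * g (n + 2)) UNIV"
      by (intro has_sum_cmult_right g_has_sum)
    moreover have "q ^ (Suc n * Suc n) * (q ^ (k * k + k * (n + 2)) * of_nat (2 * k + (n + 2))) =
                     (1 * of_nat n + 2 * of_nat k + 2) * f n k" for k
    proof -
      have "n * n + n * k + k * k + 2 * n + 2 * k + 1 = Suc n * Suc n + (k * k + k * (n + 2))"
        by (simp add: algebra_simps)
      thus ?thesis
        unfolding f_def by (simp only: power_add) (simp add: algebra_simps)
    qed
    ultimately show "((\<lambda>k. case (n, k) of (n, k) \<Rightarrow> (1 * of_nat n + 2 * of_nat k + 2) * f n k)
            has_sum q ^ (Suc n * Suc n) * g (n + 2)) UNIV"
      by simp
  qed
  thus ?thesis
    by simp
qed

lemma g_1: "g 1 = 2 * P1 + P0"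
proof -
  have "((\<lambda>n. (2 * of_nat n + 1) * q ^ (n * n + n)) has_sum g 1) UNIV"
    using g_has_sum[of 1] by (simp add: algebra_simps)
  thus ?thesis
    using P_has_sum[of 2 1] has_sum_unique by force
qed

lemma g_0: "g 0 = 2 * R1 + 2 * R0"
proof -
  have "((\<lambda>n. q ^ (Suc n * Suc n) * of_nat (2 * Suc n)) has_sum (2 * R1 + 2 * R0)) UNIV"
    using R_has_sum[of 2 2] by (simp add: algebra_simps)
  from has_sum_Suc_iff[where f = "\<lambda>n. q ^ (n * n) * of_nat (2 * n)", THEN iffD1, OF this]
  show ?thesis
    using g_has_sum[of 0] has_sum_unique by force
qed

text \<open>The numerator of the constant term; it equals \<open>G0 + 9 q\<^sup>-\<^sup>1\<^sup>/\<^sup>3 \<Psi>\<close>.\<close>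

definition X :: complex where
  "X = 1 + 6 * (R1 + R0) - 6 * (2 * P1 + P0) + (18 * E1 + 6 * E0) - (18 * F1 + 12 * F0)"

text \<open>Since (n + 1)^2 = n^2 + n + (n + 1), \<open>g_rec\<close> turns q^(n^2 + n) * g n into
  the series over \<open>f\<close> plus a linear correction.\<close>

lemma q_h_has_sum:
  "((\<lambda>n. q ^ (n * n + n) * h n) has_sum (3 * E1 + E0 - (P1 + (3 * F1 + 2 * F0)))) UNIV"
proof -
  have "((\<lambda>n. q ^ (n * n + n) * g (n + 1) - ((1 * of_nat n + 0) * q ^ (n * n + n) + q ^ (Suc n * Suc n) * g (n + 2)))
          has_sum (3 * E1 + E0 - ((1 * P1 + 0 * P0) + (3 * F1 + 2 * F0)))) UNIV"
    by (intro has_sum_diff has_sum_add g_odd_has_sum g_even_has_sum P_has_sum)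
  moreover have "q ^ (n * n + n) * g (n + 1) - ((1 * of_nat n + 0) * q ^ (n * n + n) + q ^ (Suc n * Suc n) * g (n + 2))
          = q ^ (n * n + n) * h n" for n
  proof -
    have "q ^ (Suc n * Suc n) = q ^ (n * n + n) * q ^ (n + 1)"
      unfolding power_add [symmetric] by (simp add: algebra_simps)
    moreover have "q ^ (n * n + n) * (g n - (of_nat n + q ^ (n + 1) * g (n + 2))) = 0"
      using g_rec[of n] by simp
    ultimately show ?thesis
      unfolding h_def by (simp only: mult.assoc) (simp add: right_diff_distrib distrib_left)
  qed
  ultimately show ?thesis
    by simp
qed

text \<open>Consecutive values of \<open>h\<close> add up to g (n + 2) - g n. After
  \<open>g_rec\<close> the subtracted part is the series of \<open>g_odd_has_sum\<close> without its
  initial term \<open>g 1\<close>.\<close>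

lemma q_h_h_has_sum:
  "((\<lambda>n. q ^ (Suc n * Suc n) * (h (Suc n) + h n)) has_sum
      (3 * F1 + 2 * F0 - (R1 + (3 * E1 + E0 - (2 * P1 + P0))))) UNIV"
proof -
  have "((\<lambda>n. q ^ (n * n + n) * g (n + 1)) has_sum (q ^ (0 * 0 + 0) * g (0 + 1) + (3 * E1 + E0 - g 1))) UNIV"
    using g_odd_has_sum by simp
  hence "((\<lambda>n. q ^ (Suc n * Suc n + Suc n) * g (Suc n + 1)) has_sum (3 * E1 + E0 - g 1)) UNIV"
    by (subst has_sum_Suc_iff)
  hence "((\<lambda>n. q ^ (Suc n * Suc n) * g (n + 2) -
            ((1 * of_nat n + 0) * q ^ (Suc n * Suc n) + q ^ (Suc n * Suc n + Suc n) * g (Suc n + 1)))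
          has_sum (3 * F1 + 2 * F0 - ((1 * R1 + 0 * R0) + (3 * E1 + E0 - g 1)))) UNIV"
    by (intro has_sum_diff has_sum_add g_even_has_sum R_has_sum)
  moreover have "q ^ (Suc n * Suc n) * g (n + 2) -
            ((1 * of_nat n + 0) * q ^ (Suc n * Suc n) + q ^ (Suc n * Suc n + Suc n) * g (Suc n + 1))
          = q ^ (Suc n * Suc n) * (h (Suc n) + h n)" for n
    unfolding h_def power_add[of q "Suc n * Suc n" "Suc n"] using g_rec[of n]
    by (simp add: algebra_simps)
  ultimately show ?thesis
    unfolding g_1 by (simp only:) simp
qed

text \<open>The summand 2 * h 0 - 1 is the total of \<open>A m ^ 2\<close>, so what remains for the
  cubes is \<open>X\<close>.\<close>

lemma T_term_has_sum: "(T_term has_sum (X + (2 * h 0 - 1))) UNIV"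
proof -
  define v where "v = 3 * F1 + 2 * F0 - (R1 + (3 * E1 + E0 - (2 * P1 + P0)))"
  define w where "w n = (if n = 0 then 0 else q ^ (n * n) * (2 * (h n + h (n - 1) - 1)))" for n
  have "((\<lambda>n. 2 * (q ^ (Suc n * Suc n) * (h (Suc n) + h n)) - (0 * of_nat n + 2) * q ^ (Suc n * Suc n)) has_sum
           (2 * v - (0 * R1 + 2 * R0))) UNIV"
    unfolding v_def by (intro has_sum_diff has_sum_cmult_right q_h_h_has_sum R_has_sum)
  moreover have "w (Suc n) = 2 * (q ^ (Suc n * Suc n) * (h (Suc n) + h n)) - (0 * of_nat n + 2) * q ^ (Suc n * Suc n)" for n
    by (simp add: w_def algebra_simps)
  ultimately have "((\<lambda>n. w (Suc n)) has_sum (2 * v - 2 * R0)) UNIV"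
    by simp
  hence w: "(w has_sum (2 * v - 2 * R0)) UNIV"
    by (subst (asm) has_sum_Suc_iff) (simp add: w_def)
  have "((\<lambda>n. 4 * (q ^ (n * n + n) * h n) - (0 * of_nat n + 2) * q ^ (n * n + n) - w n) has_sum
          (4 * (3 * E1 + E0 - (P1 + (3 * F1 + 2 * F0))) - (0 * P1 + 2 * P0) - (2 * v - 2 * R0))) UNIV"
    by (intro has_sum_diff has_sum_cmult_right q_h_has_sum P_has_sum w)
  moreover have "4 * (q ^ (n * n + n) * h n) - (0 * of_nat n + 2) * q ^ (n * n + n) - w n = T_term n" for n
    by (simp add: T_term_def w_def algebra_simps)
  moreover have "4 * (3 * E1 + E0 - (P1 + (3 * F1 + 2 * F0))) - (0 * P1 + 2 * P0) - (2 * v - 2 * R0) =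
                   X + (2 * h 0 - 1)"
    unfolding v_def X_def h_def using g_0 g_1 by (simp add: algebra_simps)
  ultimately show ?thesis
    by simp
qed

theorem A_cube_has_sum: "((\<lambda>m. A m ^ 3) has_sum X) UNIV"
proof -
  have "((\<lambda>m. A m ^ 3 + A m ^ 2) has_sum (X + (2 * h 0 - 1))) UNIV"
    using T_term_has_sum A_cube_has_sum_iff by blast
  from has_sum_diff[OF this A_sq_has_sum] show ?thesis
    by simp
qed

end

subsection \<open>Laurent series in one variable\<close>

text \<open>Averaging over \<open>\<plusminus>w\<close> with \<open>w\<^sup>2 = z\<close> keeps only even exponents; iterating this isolates the
  constant coefficient without integration.\<close>

lemma even_part_has_sum_0:
  fixes x :: "int \<Rightarrow> complex"
  assumes "\<And>z. norm z = 1 \<Longrightarrow> ((\<lambda>m. x m * z powi m) has_sum 0) UNIV" and "norm z = 1"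
  shows "((\<lambda>m. x (2 * m) * z powi m) has_sum 0) UNIV"
proof -
  define w where "w = csqrt z"
  have w: "w ^ 2 = z" "norm w = 1"
    using assms(2) by (simp_all add: w_def norm_csqrt)
  have w0: "w \<noteq> 0"
    using w(2) by auto
  have "((\<lambda>m. (x m * w powi m + x m * (- w) powi m) / 2) has_sum ((0 + 0) / 2)) UNIV"
    using w by (intro has_sum_divide_const has_sum_add assms(1)) auto
  also have "?this \<longleftrightarrow> ((\<lambda>m. x m * w powi m) has_sum ((0 + 0) / 2)) (range (\<lambda>m. 2 * m))"
  proof (rule has_sum_cong_neutral)
    fix m :: int
    assume "m \<in> UNIV - range (\<lambda>m. 2 * m)"
    hence "odd m"
      by auto
    thus "(x m * w powi m + x m * (- w) powi m) / 2 = 0"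
      by (simp add: power_int_minus_left)
  qed (auto simp: power_int_minus_left)
  finally have "((\<lambda>m. x m * w powi m) has_sum 0) (range (\<lambda>m. 2 * m))"
    by simp
  hence "((\<lambda>m. x (2 * m) * w powi (2 * m)) has_sum 0) UNIV"
    by (subst (asm) has_sum_reindex) (auto simp: inj_def o_def)
  thus ?thesis
    by (simp add: power_int_mult w)
qed

lemma Laurent_coeff_0_eq_0:
  fixes x :: "int \<Rightarrow> complex"
  assumes x: "\<And>z. norm z = 1 \<Longrightarrow> ((\<lambda>m. x m * z powi m) has_sum 0) UNIV"
  shows "x 0 = 0"
proof (rule ccontr)
  assume "x 0 \<noteq> 0"
  have multiples: "((\<lambda>m. x (2 ^ i * m) * z powi m) has_sum 0) UNIV" if "norm z = 1" for i z
    using that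
  proof (induction i arbitrary: z)
    case (Suc i)
    from even_part_has_sum_0[where x = "\<lambda>m. x (2 ^ i * m)", OF Suc.IH Suc.prems] show ?case
      by (simp add: mult_ac)
  qed (use x in auto)
  have "x summable_on UNIV"
    using x[of 1] by (auto simp: summable_on_def)
  hence summ: "(\<lambda>m. norm (x m)) summable_on UNIV"
    by (simp add: summable_on_iff_abs_summable_on_complex)
  then obtain S where S: "((\<lambda>m. norm (x m)) has_sum S) UNIV"
    by (auto simp: summable_on_def)
  obtain F where F: "finite F" "dist (\<Sum>m\<in>F. norm (x m)) S \<le> norm (x 0) / 2"
    using has_sum_finite_approximation[OF S, of "norm (x 0) / 2"] \<open>x 0 \<noteq> 0\<close> by auto
  \<comment> \<open>F carries all of the absolute sum except at most |x 0| / 2. Once 2^i exceeds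
    every exponent in F, the nonzero multiples of 2^i lie outside F; they sum to - x 0, too large
    for that tail.\<close>
  obtain i where i: "\<And>m. m \<in> F \<Longrightarrow> \<bar>m\<bar> < 2 ^ i"
  proof -
    obtain M where M: "\<And>m. m \<in> F \<Longrightarrow> \<bar>m\<bar> \<le> M"
      using finite_imageI[OF F(1), of abs] by (metis Max_ge image_eqI)
    have "M < 2 ^ nat M"
    proof (cases "M \<ge> 0")
      case True
      have "int (nat M) < int (2 ^ nat M)"
        by (subst of_nat_less_iff) (rule less_exp)
      thus ?thesis
        using True by simp
    qed (simp add: less_le_trans)
    thus ?thesis
      using M that by (meson le_less_trans)
  qed
  define I where "I = range (\<lambda>m :: int. 2 ^ i * m) - {0}"
  have "(x has_sum 0) (range (\<lambda>m :: int. 2 ^ i * m))"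
    using multiples[of 1 i] by (subst has_sum_reindex) (auto simp: inj_def o_def)
  moreover have "(x has_sum x 0) {0}"
    by (rule has_sum_finiteI) auto
  ultimately have "(x has_sum (0 - x 0)) I"
    unfolding I_def by (intro has_sum_Diff) (auto simp: image_iff)
  moreover have "F \<inter> I = {}"
  proof (safe, goal_cases)
    case (1 m)
    then obtain n where n: "m = 2 ^ i * n" "n \<noteq> 0"
      by (auto simp: I_def)
    hence "2 ^ i * 1 \<le> 2 ^ i * \<bar>n\<bar>"
      by (intro mult_left_mono) auto
    thus ?case
      using i[OF 1(1)] n by (simp add: abs_mult)
  qed
  moreover have "((\<lambda>m. norm (x m)) has_sum (S - (\<Sum>m\<in>F. norm (x m)))) (UNIV - F)"
    using F(1) by (intro has_sum_Diff S has_sum_finite) auto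
  moreover have "(\<lambda>m. norm (x m)) summable_on I"
    using summ by (rule summable_on_subset_banach) auto
  ultimately have "norm (0 - x 0) \<le> S - (\<Sum>m\<in>F. norm (x m))"
    by (intro order_trans[OF norm_has_sum_bound[OF has_sum_infsum]]
          has_sum_mono2[OF has_sum_infsum]) auto
  moreover have "norm (x 0) > 0"
    using \<open>x 0 \<noteq> 0\<close> by simp
  moreover have "S - (\<Sum>m\<in>F. norm (x m)) \<le> norm (x 0) / 2"
    using F(2) unfolding dist_real_def by linarith
  ultimately show False
    by simp
qed

text \<open>Scaling z by r reduces to the unit circle, and division by z^k moves the k-th
  coefficient to position 0.\<close>

lemma Laurent_coeff_eq_0:
  fixes c :: "int \<Rightarrow> complex"
  assumes "r > 0" and c: "\<And>z. norm z = r \<Longrightarrow> ((\<lambda>m. c m * z powi m) has_sum 0) UNIV"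
  shows "c k = 0"
proof -
  have "((\<lambda>m. c (m + k) * of_real r powi (m + k) * z powi m) has_sum 0) UNIV" if z: "norm z = 1" for z
  proof -
    have z0: "z \<noteq> 0"
      using z by auto
    have "((\<lambda>m. c m * (of_real r * z) powi m) has_sum 0) UNIV"
      using z \<open>r > 0\<close> by (intro c) (auto simp: norm_mult)
    hence "((\<lambda>m. c (m + k) * (of_real r * z) powi (m + k)) has_sum 0) UNIV"
      by (subst has_sum_int_shift)
    from has_sum_cmult_left[OF this, of "z powi (- k)"] show ?thesis
      using z0 by (simp add: power_int_mult_distrib power_int_add power_int_minus field_simps)
  qed
  from Laurent_coeff_0_eq_0[OF this] show ?thesis
    using \<open>r > 0\<close> by simp
qed

lemma Laurent_coeff_unique:
  fixes c :: "int \<Rightarrow> complex"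
  assumes "r > 0" and "\<And>z. norm z = r \<Longrightarrow> ((\<lambda>m. c m * z powi m) has_sum F z) UNIV"
    and "\<And>z. norm z = r \<Longrightarrow> ((\<lambda>m. d m * z powi m) has_sum F z) UNIV"
  shows "c k = d k"
proof -
  have "((\<lambda>m. (c m - d m) * z powi m) has_sum 0) UNIV" if "norm z = r" for z
    using has_sum_diff[OF assms(2,3)[OF that]] by (simp add: algebra_simps)
  from Laurent_coeff_eq_0[OF \<open>r > 0\<close> this, of k] show ?thesis
    by simp
qed

section \<open>Products of absolutely convergent Laurent series\<close>

lemma has_sum_mult:
  fixes f :: "'a \<Rightarrow> complex" and g :: "'b \<Rightarrow> complex"
  assumes f: "(f has_sum a) UNIV" and g: "(g has_sum b) UNIV"
  shows "((\<lambda>(x, y). f x * g y) has_sum (a * b)) UNIV"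
proof -
  have "f summable_on UNIV" "g summable_on UNIV"
    using f g by (auto simp: summable_on_def)
  hence "(\<lambda>(x, y). norm (f x) * norm (g y)) summable_on UNIV"
    by (intro summable_on_product) (auto simp: summable_on_iff_abs_summable_on_complex)
  hence "(\<lambda>(x, y). f x * g y) summable_on UNIV"
    by (rule summable_on_complex_comparison) (auto simp: norm_mult)
  hence "((\<lambda>(x, y). f x * g y) has_sum (a * b)) (UNIV \<times> UNIV)"
    by (intro has_sum_SigmaI[where g = "\<lambda>x. f x * b"])
       (auto intro!: has_sum_cmult_right has_sum_cmult_left f g)
  thus ?thesis
    by simp
qed

lemma Laurent_mult_has_sum:
  fixes a b :: "int \<Rightarrow> complex"
  assumes a: "((\<lambda>m. a m * z powi m) has_sum f) UNIV"
    and b: "((\<lambda>m. b m * z powi m) has_sum g) UNIV" and z: "z \<noteq> 0"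
    and conv: "\<And>m. ((\<lambda>j. a j * b (m - j)) has_sum c m) UNIV"
  shows "((\<lambda>m. c m * z powi m) has_sum (f * g)) UNIV"
proof -
  have "((\<lambda>(j, m). a j * z powi j * (b m * z powi m)) has_sum (f * g)) UNIV"
    by (rule has_sum_mult[OF a b])
  also have "?this \<longleftrightarrow> ((\<lambda>(m, j). a j * b (m - j) * z powi m) has_sum (f * g)) (UNIV \<times> UNIV)"
  proof (rule has_sum_reindex_bij_witness[of _ "\<lambda>(m, j). (j, m - j)" "\<lambda>(j, m). (j + m, j)"], goal_cases)
    case (5 p)
    thus ?case
      using z by (auto simp: power_int_add split: prod.splits)
  qed auto
  finally show ?thesis
    by (rule has_sum_SigmaD) (auto intro!: has_sum_cmult_left conv)
qed

text \<open>For fixed m the convolution is, up to the constant factor z^m, an antidiagonal of the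
  summable double family of products.\<close>

lemma Laurent_mult_summable:
  fixes a b :: "int \<Rightarrow> complex"
  assumes a: "(\<lambda>m. a m * z powi m) summable_on UNIV"
    and b: "(\<lambda>m. b m * z powi m) summable_on UNIV" and z: "z \<noteq> 0"
  shows "(\<lambda>j. a j * b (m - j)) summable_on UNIV"
proof -
  obtain f g where fg: "((\<lambda>m. a m * z powi m) has_sum f) UNIV" "((\<lambda>m. b m * z powi m) has_sum g) UNIV"
    using a b by (auto simp: summable_on_def)
  have "(\<lambda>(j, k). a j * z powi j * (b k * z powi k)) summable_on UNIV"
    using has_sum_mult[OF fg] by (auto simp: summable_on_def)
  hence "(\<lambda>(j, k). a j * z powi j * (b k * z powi k)) summable_on range (\<lambda>j. (j, m - j))"
    by (rule summable_on_subset_banach) auto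
  hence "(\<lambda>j. a j * z powi j * (b (m - j) * z powi (m - j))) summable_on UNIV"
    by (subst (asm) summable_on_reindex) (auto simp: inj_def o_def)
  hence "(\<lambda>j. a j * z powi j * (b (m - j) * z powi (m - j)) * inverse (z powi m)) summable_on UNIV"
    by (rule summable_on_cmult_left)
  moreover have "a j * z powi j * (b (m - j) * z powi (m - j)) * inverse (z powi m) = a j * b (m - j)" for j
    using z by (simp add: power_int_diff field_simps)
  ultimately show ?thesis
    by simp
qed

subsection \<open>The theta function\<close>

context nome
begin

lemma qpoch_convergent: "convergent_prod (\<lambda>j. 1 - a * q ^ j)"
proof -
  have "summable (\<lambda>j. norm (a * q ^ j))"
    using norm_q by (simp add: norm_mult norm_power summable_geometric)
  hence "summable (\<lambda>j. norm ((1 - a * q ^ j) - 1))"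
    by simp
  thus ?thesis
    by (intro abs_convergent_prod_imp_convergent_prod summable_imp_abs_convergent_prod)
qed

lemma qpoch_rec: "qpoch a q = (1 - a) * qpoch (a * q) q"
proof -
  have "(\<lambda>n. \<Prod>i\<le>n. 1 - a * q ^ i) \<longlonglongrightarrow> qpoch a q"
    unfolding qpoch_def by (rule convergent_prod_LIMSEQ[OF qpoch_convergent])
  hence "(\<lambda>n. \<Prod>i\<le>Suc n. 1 - a * q ^ i) \<longlonglongrightarrow> qpoch a q"
    by (rule LIMSEQ_Suc)
  moreover have "(\<Prod>i\<le>Suc n. 1 - a * q ^ i) = (1 - a) * (\<Prod>i\<le>n. 1 - (a * q) * q ^ i)" for n
    by (subst prod.atMost_Suc_shift) (simp add: mult_ac)
  moreover have "(\<lambda>n. (1 - a) * (\<Prod>i\<le>n. 1 - (a * q) * q ^ i)) \<longlonglongrightarrow> (1 - a) * qpoch (a * q) q"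
    unfolding qpoch_def by (intro tendsto_mult tendsto_const convergent_prod_LIMSEQ[OF qpoch_convergent])
  ultimately show ?thesis
    using LIMSEQ_unique by simp
qed

lemma one_minus_q_power_nz: "1 - q ^ Suc i \<noteq> 0"
proof
  assume "1 - q ^ Suc i = 0"
  hence "norm (q ^ Suc i) = 1"
    by simp
  moreover have "norm q ^ Suc i < 1"
    using norm_q norm_q_pos by (intro power_Suc_less_one) auto
  ultimately show False
    by (simp only: norm_power)
qed

lemma qpoch_q_q_nz: "qpoch q q \<noteq> 0"
  unfolding qpoch_def using one_minus_q_power_nz by (intro prodinf_nonzero qpoch_convergent) simp_all

text \<open>Euler's coefficients (-1)^i q^(i(i-1)/2) / (q;q)_i, encoded by the recurrence that the
  functional equation E(z) = (1 - z) E(zq) imposes.\<close>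

primrec euler_coeff :: "nat \<Rightarrow> complex" where
  "euler_coeff 0 = 1"
| "euler_coeff (Suc i) = - (q ^ i * euler_coeff i / (1 - q ^ Suc i))"

lemma euler_coeff_summable: "summable (\<lambda>i. norm (euler_coeff i * z ^ i))"
proof -
  have "(\<lambda>i. norm q ^ i * norm z / (1 - norm q)) \<longlonglongrightarrow> 0 * norm z / (1 - norm q)"
    using norm_q by (intro tendsto_intros LIMSEQ_power_zero) auto
  hence "\<forall>\<^sub>F i in sequentially. norm q ^ i * norm z / (1 - norm q) < 1 / 2"
    by (rule order_tendstoD) auto
  then obtain N where N: "\<And>i. i \<ge> N \<Longrightarrow> norm q ^ i * norm z / (1 - norm q) < 1 / 2"
    by (auto simp: eventually_sequentially)
  show ?thesis
  proof (rule summable_ratio_test[of "1 / 2" N])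
    fix i assume i: "i \<ge> N"
    have "1 - norm q \<le> norm (1 - q ^ Suc i)"
    proof -
      have "norm (q ^ Suc i) \<le> norm q ^ 1"
        by (rule norm_q_power_le) simp
      thus ?thesis
        using norm_triangle_ineq2[of 1 "q ^ Suc i"] by simp
    qed
    hence "norm q ^ i * norm z / norm (1 - q ^ Suc i) \<le> norm q ^ i * norm z / (1 - norm q)"
      using norm_q one_minus_q_power_nz[of i] by (intro divide_left_mono mult_pos_pos) auto
    with N[OF i] have le: "norm q ^ i * norm z / norm (1 - q ^ Suc i) \<le> 1 / 2"
      by linarith
    have "norm (euler_coeff (Suc i) * z ^ Suc i) =
            norm q ^ i * norm z / norm (1 - q ^ Suc i) * norm (euler_coeff i * z ^ i)"
      by (simp add: norm_mult norm_divide norm_power)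
    also have "\<dots> \<le> 1 / 2 * norm (euler_coeff i * z ^ i)"
      by (intro mult_right_mono le) auto
    finally show "norm (norm (euler_coeff (Suc i) * z ^ Suc i)) \<le> 1 / 2 * norm (norm (euler_coeff i * z ^ i))"
      by simp
  qed auto
qed

text \<open>The power series obeys the functional equation of the product. Iteration gives E z as a
  finite product times E (z q^n), and continuity at 0 with E 0 = 1 yields the limit.\<close>

lemma euler_has_sum: "((\<lambda>i. euler_coeff i * z ^ i) has_sum qpoch z q) UNIV"
proof -
  define E where "E z = (\<Sum>i. euler_coeff i * z ^ i)" for z
  have E: "(\<lambda>i. euler_coeff i * z ^ i) sums E z" for z
    unfolding E_def by (intro summable_sums summable_norm_cancel[OF euler_coeff_summable])
  have E_rec: "E z = (1 - z) * E (z * q)" for z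
  proof -
    have "(\<lambda>i. euler_coeff i * z ^ i - euler_coeff i * (z * q) ^ i) sums (E z - E (z * q))"
      by (intro sums_diff E)
    moreover have "(\<lambda>i. if i = 0 then 0 else - z * (euler_coeff (i - 1) * (z * q) ^ (i - 1)))
                     sums (- z * E (z * q) + (if (0::nat) = 0 then 0 else - z * (euler_coeff (0 - 1) * (z * q) ^ (0 - 1))))"
      by (subst sums_Suc_iff [symmetric]) (use sums_mult[OF E, of "- z"] in simp)
    moreover have "euler_coeff i * z ^ i - euler_coeff i * (z * q) ^ i =
        (if i = 0 then 0 else - z * (euler_coeff (i - 1) * (z * q) ^ (i - 1)))" for i
    proof (cases i)
      case (Suc j)
      have "euler_coeff i * z ^ i - euler_coeff i * (z * q) ^ i = euler_coeff i * (1 - q ^ i) * z ^ i"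
        by (simp only: power_mult_distrib) (simp add: algebra_simps)
      also have "euler_coeff i * (1 - q ^ i) = - (q ^ j * euler_coeff j)"
        using one_minus_q_power_nz[of j] Suc by simp
      finally show ?thesis
        using Suc by (simp add: power_mult_distrib)
    qed auto
    ultimately have "E z - E (z * q) = - z * E (z * q)"
      using sums_unique2 by fastforce
    thus ?thesis
      by (simp add: algebra_simps)
  qed
  have prod: "E z = (\<Prod>i<n. 1 - z * q ^ i) * E (z * q ^ n)" for n
  proof (induction n)
    case (Suc n)
    thus ?case
      using E_rec[of "z * q ^ n"] by (simp add: mult_ac)
  qed auto
  have "isCont E 0"
    unfolding E_def by (rule isCont_powser'[where K = 1]) (use summable_norm_cancel[OF euler_coeff_summable[of 1]] in auto)
  moreover have "(\<lambda>n. z * q ^ Suc n) \<longlonglongrightarrow> z * 0"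
    using norm_q by (intro tendsto_mult tendsto_const LIMSEQ_Suc[OF LIMSEQ_power_zero]) auto
  ultimately have "(\<lambda>n. E (z * q ^ Suc n)) \<longlonglongrightarrow> E 0"
    by (intro isCont_tendsto_compose[of 0 E]) auto
  moreover have "E 0 = 1"
    using powser_sums_zero_iff[of euler_coeff "E 0"] E[of 0] by simp
  moreover have "(\<lambda>n. \<Prod>i<Suc n. 1 - z * q ^ i) \<longlonglongrightarrow> qpoch z q"
    unfolding qpoch_def lessThan_Suc_atMost by (rule convergent_prod_LIMSEQ[OF qpoch_convergent])
  ultimately have "(\<lambda>n. (\<Prod>i<Suc n. 1 - z * q ^ i) * E (z * q ^ Suc n)) \<longlonglongrightarrow> qpoch z q * 1"
    by (intro tendsto_mult) auto
  hence "E z = qpoch z q"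
    by (simp only: prod [symmetric] LIMSEQ_const_iff) simp
  thus ?thesis
    using E[of z] euler_coeff_summable by (intro norm_summable_imp_has_sum) auto
qed

lemma euler_Laurent_has_sum:
  "((\<lambda>m. (if m \<ge> 0 then euler_coeff (nat m) * a ^ nat m else 0) * z powi m) has_sum qpoch (a * z) q) UNIV"
proof -
  have "((\<lambda>n. euler_coeff n * a ^ n * z ^ n) has_sum qpoch (a * z) q) UNIV"
    using euler_has_sum[of "a * z"] by (simp add: power_mult_distrib mult_ac)
  hence "((\<lambda>m. (if m \<ge> 0 then euler_coeff (nat m) * a ^ nat m else 0) * z powi m) has_sum (qpoch (a * z) q + 0)) UNIV"
    by (intro has_sum_int_split) auto
  thus ?thesis
    by simp
qed

text \<open>The denominator contributed by one variable of \<open>G_fun\<close>. Times 1 - z it is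
  (z, q/z; q), Jacobi's theta product without the factor (q;q).\<close>

definition K :: "complex \<Rightarrow> complex" where
  "K z = qpoch (z * q) q * qpoch (inverse z * q) q"

lemma K_Laurent:
  obtains k where "\<And>z. z \<noteq> 0 \<Longrightarrow> ((\<lambda>m. k m * z powi m) has_sum K z) UNIV"
proof -
  define a b where "a m = (if m \<ge> 0 then euler_coeff (nat m) * q ^ nat m else 0)" and "b m = a (- m)" for m :: int
  have a: "((\<lambda>m. a m * z powi m) has_sum qpoch (q * z) q) UNIV" for z
    unfolding a_def by (rule euler_Laurent_has_sum)
  have b: "((\<lambda>m. b m * z powi m) has_sum qpoch (q * inverse z) q) UNIV" for z
  proof -
    have "((\<lambda>m. a (0 - m) * inverse z powi (0 - m)) has_sum qpoch (q * inverse z) q) UNIV"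
      using a[of "inverse z"] by (subst has_sum_int_reflect[where f = "\<lambda>m. a m * inverse z powi m"])
    thus ?thesis
      by (simp add: b_def power_int_minus power_int_inverse)
  qed
  define k where "k m = (\<Sum>\<^sub>\<infinity>j. a j * b (m - j))" for m
  have "((\<lambda>j. a j * b (m - j)) has_sum k m) UNIV" for m
    unfolding k_def using a[of 1] b[of 1]
    by (intro has_sum_infsum Laurent_mult_summable[of _ 1]) (auto simp: summable_on_def)
  hence "((\<lambda>m. k m * z powi m) has_sum K z) UNIV" if "z \<noteq> 0" for z
    using Laurent_mult_has_sum[OF a[of z] b[of z] that] by (simp add: K_def mult.commute)
  thus thesis
    using that by blast
qed

text \<open>Replacing z by zq moves one factor between the products: (1 - zq)(zq^2;q) = (zq;q), and
  (1/z;q) = (1 - 1/z)(q/z;q).\<close>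

lemma theta_quasi_period:
  assumes "z \<noteq> 0"
  shows "(1 - z * q) * K (z * q) = - (inverse z * ((1 - z) * K z))"
proof -
  have *: "inverse (z * q) * q = inverse z"
    using q_nz by simp
  have "(1 - z * q) * K (z * q) = (1 - z * q) * qpoch (z * q * q) q * qpoch (inverse (z * q) * q) q"
    by (simp only: K_def mult.assoc)
  also have "\<dots> = qpoch (z * q) q * qpoch (inverse z) q"
    by (simp only: * qpoch_rec[of "z * q", symmetric])
  also have "\<dots> = (1 - inverse z) * K z"
    using qpoch_rec[of "inverse z"] by (simp add: K_def)
  also have "1 - inverse z = - (inverse z * (1 - z))"
    using assms by (simp add: field_simps)
  finally show ?thesis
    by simp
qed

lemma A_Laurent_summable:
  assumes "norm q < norm z" "norm z * norm q < 1"
  shows "(\<lambda>m. A m * z powi m) summable_on UNIV"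
proof -
  obtain C where "\<And>m. norm (A m) \<le> C * norm q ^ nat \<bar>m\<bar>"
    using A_bound by blast
  from Laurent_summable_on_int[OF this norm_q_pos assms] show ?thesis
    by (rule abs_summable_summable)
qed

text \<open>The quasi-period of \<open>\<theta>(z) = (1 - z) K(z)\<close> and the recurrence for \<open>B\<close> force
  \<open>x M = q powi M * x M\<close> for the Laurent coefficients \<open>x\<close> of \<open>(\<Sum>m. A m z\<^sup>m) K(z)\<close>, so only \<open>x 0\<close>
  survives; its value is read off at \<open>z = 1\<close>.\<close>

lemma A_K_eq:
  assumes z: "norm q < norm z" "norm z * norm q < 1"
  shows "(\<Sum>\<^sub>\<infinity>m. A m * z powi m) * K z = qpoch q q ^ 2"
proof -
  obtain k where k: "\<And>z. z \<noteq> 0 \<Longrightarrow> ((\<lambda>m. k m * z powi m) has_sum K z) UNIV"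
    using K_Laurent by blast
  define t where "t m = k m - k (m - 1)" for m
  have t: "((\<lambda>m. t m * z powi m) has_sum (1 - z) * K z) UNIV" if "z \<noteq> 0" for z
  proof -
    have "((\<lambda>m. k (m + (- 1)) * z powi (m + (- 1))) has_sum K z) UNIV"
      using k[OF that] by (subst has_sum_int_shift[where f = "\<lambda>m. k m * z powi m"])
    from has_sum_diff[OF k[OF that] has_sum_cmult_left[OF this, of z]] show ?thesis
      using that by (simp add: t_def power_int_diff algebra_simps)
  qed
  have t_rec: "t (m + 1) = - (q powi m * t m)" for m
  proof -
    have "- (q powi m * t m) = t (m + 1)"
    proof (rule Laurent_coeff_unique[where r = 1 and c = "\<lambda>m. - (q powi m * t m)" and d = "\<lambda>m. t (m + 1)"])
      fix z :: complex assume "norm z = 1"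
      hence z0: "z \<noteq> 0"
        by auto
      have "((\<lambda>m. - (t m * (z * q) powi m)) has_sum - ((1 - z * q) * K (z * q))) UNIV"
        using z0 q_nz by (intro has_sum_uminusI t) auto
      thus "((\<lambda>m. - (q powi m * t m) * z powi m) has_sum inverse z * ((1 - z) * K z)) UNIV"
        using theta_quasi_period[OF z0] by (simp add: power_int_mult_distrib mult_ac)
      have "((\<lambda>m. t (m + 1) * z powi (m + 1)) has_sum (1 - z) * K z) UNIV"
        using t[OF z0] by (subst has_sum_int_shift[where f = "\<lambda>m. t m * z powi m"])
      from has_sum_cmult_right[OF this, of "inverse z"]
      show "((\<lambda>m. t (m + 1) * z powi m) has_sum inverse z * ((1 - z) * K z)) UNIV"
        using z0 by (simp add: power_int_add field_simps)
    qed auto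
    thus ?thesis
      by simp
  qed
  have k1: "(k has_sum K 1) UNIV" and t1: "(t has_sum 0) UNIV"
    using k[of 1] t[of 1] by auto
  obtain C where C: "\<And>m. norm (B m) \<le> C"
    using B_bound by blast
  have B_summable: "(\<lambda>j. B j * c (M - j)) summable_on UNIV" if "c summable_on UNIV" for c and M :: int
  proof -
    have "(\<lambda>j. c (M - j)) summable_on UNIV"
      using that has_sum_int_reflect[of c] by (auto simp: summable_on_def)
    hence "(\<lambda>j. C * norm (c (M - j))) summable_on UNIV"
      by (intro summable_on_cmult_right) (simp add: summable_on_iff_abs_summable_on_complex)
    thus ?thesis
      by (rule summable_on_complex_comparison) (auto simp: norm_mult intro!: mult_right_mono C)
  qed
  \<comment> \<open>Summation by parts, carried out in \<open>A_k\<close>, moves the difference from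
    \<open>A\<close> to \<open>k\<close>, so these are the coefficients of the product in a form to
    which the recurrence of \<open>B\<close> applies. The sum converges because \<open>B\<close> is
    bounded and t is summable.\<close>
  define x where "x M = (\<Sum>\<^sub>\<infinity>j. B j * t (M - j))" for M
  have x: "((\<lambda>j. B j * t (M - j)) has_sum x M) UNIV" for M
    unfolding x_def using t1 by (intro has_sum_infsum B_summable) (auto simp: summable_on_def)
  have x_0: "x M = 0" if "M \<noteq> 0" for M
  proof -
    \<comment> \<open>The values of t sum to 0 because (1 - z) K z vanishes at z = 1. They supply
      the 1 in B (j - 1) = 1 - q^j B j, while q^j t (M + 1 - j) = - q^M t (M - j) makes the
      remaining power independent of j.\<close>
    have "((\<lambda>j. t (M + 1 - j) - (- (q powi M)) * (B j * t (M - j))) has_sum (0 - (- (q powi M)) * x M)) UNIV"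
      using t1 by (intro has_sum_diff has_sum_cmult_right x) (subst has_sum_int_reflect)
    moreover have "t (M + 1 - j) - (- (q powi M)) * (B j * t (M - j)) = B (j + (- 1)) * t (M - (j + (- 1)))" for j
    proof -
      have "q powi j * t (M + 1 - j) = - (q powi M * t (M - j))"
        using t_rec[of "M - j"] q_nz by (simp add: power_int_diff field_simps)
      moreover have "B (j + (- 1)) = 1 - q powi j * B j"
        using B_rec[of "j - 1"] by simp
      moreover have "(1 - q powi j * B j) * t (M + 1 - j) = t (M + 1 - j) - B j * (q powi j * t (M + 1 - j))"
        by (simp add: algebra_simps)
      moreover have "M - (j + - 1) = M + 1 - j"
        by simp
      ultimately show ?thesis
        by (simp only:) simp
    qed
    ultimately have "((\<lambda>j. B (j + (- 1)) * t (M - (j + (- 1)))) has_sum (q powi M * x M)) UNIV"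
      by simp
    hence "((\<lambda>j. B j * t (M - j)) has_sum (q powi M * x M)) UNIV"
      by (subst (asm) has_sum_int_shift[where f = "\<lambda>j. B j * t (M - j)"])
    hence "x M = q powi M * x M"
      using x has_sum_unique by blast
    moreover have "q powi M \<noteq> 1"
    proof
      assume 1: "q powi M = 1"
      define N where "N = nat \<bar>M\<bar>"
      obtain i where i: "N = Suc i"
        using \<open>M \<noteq> 0\<close> by (cases N) (auto simp: N_def)
      have "M = int N \<or> M = - int N"
        by (auto simp: N_def)
      hence "q ^ N = 1"
        using 1 by (auto simp: power_int_minus)
      thus False
        using one_minus_q_power_nz[of i] i by simp
    qed
    ultimately show ?thesis
      by simp
  qed
  have A_k: "((\<lambda>j. A j * k (M - j)) has_sum x M) UNIV" for M
  proof -
    obtain s where s: "((\<lambda>j. B j * k (M - 1 - j)) has_sum s) UNIV"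
      using B_summable[of k "M - 1"] k1 by (auto simp: summable_on_def)
    from has_sum_add[OF x[of M] this]
    have "((\<lambda>j. B j * k (M - j)) has_sum (x M + s)) UNIV"
      by (simp add: t_def algebra_simps)
    moreover have "((\<lambda>j. B (j + (- 1)) * k (M - 1 - (j + (- 1)))) has_sum s) UNIV"
      using s by (subst has_sum_int_shift[where f = "\<lambda>j. B j * k (M - 1 - j)"])
    ultimately have "((\<lambda>j. B j * k (M - j) - B (j + (- 1)) * k (M - 1 - (j + (- 1)))) has_sum (x M + s - s)) UNIV"
      by (rule has_sum_diff)
    thus ?thesis
      by (simp add: A_def algebra_simps)
  qed
  have const: "(\<Sum>\<^sub>\<infinity>m. A m * z powi m) * K z = x 0" if z: "norm q < norm z" "norm z * norm q < 1" for z
  proof -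
    have z0: "z \<noteq> 0"
      using z norm_q_pos by auto
    have "((\<lambda>m. x m * z powi m) has_sum ((\<Sum>\<^sub>\<infinity>m. A m * z powi m) * K z)) UNIV"
      using z z0 by (intro Laurent_mult_has_sum[OF has_sum_infsum k _ A_k] A_Laurent_summable)
    moreover have "((\<lambda>m. x m * z powi m) has_sum x 0) UNIV"
      by (rule has_sum_finite_neutralI[of "{0}"]) (auto simp: x_0)
    ultimately show ?thesis
      using has_sum_unique by blast
  qed
  have "(\<Sum>\<^sub>\<infinity>m. A m * 1 powi m) = 1"
    using A_has_sum by (simp add: infsumI)
  hence "x 0 = K 1"
    using const[of 1] norm_q by simp
  also have "K 1 = qpoch q q ^ 2"
    by (simp add: K_def power2_eq_square)
  finally show ?thesis
    using const[OF z] by simp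
qed

end

subsection \<open>The constant term\<close>

text \<open>One-variable uniqueness is used twice: for fixed x in the variable y, which kills each
  sum over m, and then for those sums as series in x.\<close>

lemma Laurent_coeff2_unique:
  fixes c d :: "int \<times> int \<Rightarrow> complex"
  assumes r: "r > 0"
    and c: "\<And>x y. norm x = r \<Longrightarrow> norm y = r \<Longrightarrow>
              ((\<lambda>(m, n). c (m, n) * x powi m * y powi n) has_sum F x y) UNIV"
    and d: "\<And>x y. norm x = r \<Longrightarrow> norm y = r \<Longrightarrow>
              ((\<lambda>(m, n). d (m, n) * x powi m * y powi n) has_sum F x y) UNIV"
  shows "c = d"
proof -
  define b where "b p = c p - d p" for p
  have b: "((\<lambda>(m, n). b (m, n) * x powi m * y powi n) has_sum 0) UNIV" if "norm x = r" "norm y = r" for x y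
    using has_sum_diff[OF c[OF that] d[OF that]] by (simp add: b_def case_prod_unfold algebra_simps)
  have row: "((\<lambda>m. b (m, n) * x powi m) has_sum 0) UNIV" if x: "norm x = r" for x n
  proof -
    have "((\<lambda>(n, m). b (m, n) * x powi m * y powi n) has_sum 0) (UNIV \<times> UNIV)" if "norm y = r" for y
      using b[OF x that] unfolding UNIV_Times_UNIV [symmetric] by (subst (asm) has_sum_swap) simp
    note b' = this
    have summ: "(\<lambda>m. b (m, n) * x powi m) summable_on UNIV" for n
    proof -
      define y :: complex where "y = of_real r"
      have y: "norm y = r" "y \<noteq> 0"
        using r by (auto simp: y_def)
      have "(\<lambda>(n, m). b (m, n) * x powi m * y powi n) summable_on range (\<lambda>m. (n, m))"
        by (rule summable_on_subset_banach[OF has_sum_imp_summable[OF b'[OF y(1)]]]) auto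
      hence "(\<lambda>m. b (m, n) * x powi m * y powi n) summable_on UNIV"
        by (subst (asm) summable_on_reindex) (auto simp: inj_def o_def)
      thus ?thesis
        using y by (subst (asm) summable_on_cmult_left') auto
    qed
    have "((\<lambda>n. (\<Sum>\<^sub>\<infinity>m. b (m, n) * x powi m) * y powi n) has_sum 0) UNIV" if "norm y = r" for y
      by (rule has_sum_SigmaD[OF b'[OF that]]) (auto intro!: has_sum_cmult_left has_sum_infsum summ)
    from Laurent_coeff_eq_0[OF r this] have "(\<Sum>\<^sub>\<infinity>m. b (m, n) * x powi m) = 0"
      by blast
    thus ?thesis
      using has_sum_infsum[OF summ] by metis
  qed
  have "b (m, n) = 0" for m n
    using Laurent_coeff_eq_0[OF r row] .
  thus ?thesis
    by (auto simp: b_def fun_eq_iff)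
qed

context nome
begin

lemma inverse_K_has_sum:
  assumes z: "norm q < norm z" "norm z * norm q < 1"
  shows "((\<lambda>m. A m * z powi m) has_sum qpoch q q ^ 2 / K z) UNIV"
proof -
  have "K z \<noteq> 0"
    using A_K_eq[OF z] qpoch_q_q_nz by auto
  hence "(\<Sum>\<^sub>\<infinity>m. A m * z powi m) = qpoch q q ^ 2 / K z"
    using A_K_eq[OF z] by (simp add: field_simps)
  thus ?thesis
    using has_sum_infsum[OF A_Laurent_summable[OF z]] by simp
qed

text \<open>The third series runs in the product of both variables, so its exponent k counts towards
  m and n alike. Each of the three series carries a factor (q;q)^2, hence the sixth power.\<close>

definition G_coeff :: "int \<times> int \<Rightarrow> complex" where
  "G_coeff = (\<lambda>(m, n). (\<Sum>\<^sub>\<infinity>k. A (m - k) * A (n - k) * A k) / qpoch q q ^ 6)"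

lemma triple_summable: "(\<lambda>k. A (m - k) * A (n - k) * A k) summable_on UNIV"
proof -
  obtain C where C: "\<And>m. norm (B m) \<le> C"
    using B_bound by blast
  define D where "D = C + C"
  have A_le: "norm (A m) \<le> D" for m
    unfolding A_def D_def by (intro order_trans[OF norm_triangle_ineq4] add_mono C)
  have "D \<ge> 0"
    using A_le[of 0] norm_ge_zero order_trans by blast
  have "(\<lambda>k. D * D * norm (A k)) summable_on UNIV"
    by (intro summable_on_cmult_right A_abs_summable)
  thus ?thesis
    by (rule summable_on_complex_comparison)
       (use A_le \<open>D \<ge> 0\<close> in \<open>auto simp: norm_mult intro!: mult_right_mono mult_mono\<close>)
qed

lemma laurent_expansion_G: "laurent_expansion_on (zeta_range q) (G_fun q) G_coeff"
  unfolding laurent_expansion_on_def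
proof safe
  fix x y
  assume "(x, y) \<in> zeta_range q"
  hence norms: "norm q < norm x" "norm x < 1" "norm q < norm y" "norm y < 1"
    "norm q < norm (x * y)" "norm (x * y) < 1"
    by (auto simp: zeta_range_def)
  have le: "norm z * norm q < 1" if "norm z < 1" for z
    using mult_strict_mono[OF that norm_q] by simp
  have nz: "x \<noteq> 0" "y \<noteq> 0"
    using norms by auto
  define P where "P = (qpoch q q ^ 2 / K x) * ((qpoch q q ^ 2 / K y) * (qpoch q q ^ 2 / K (x * y)))"
  have "((\<lambda>(i, p). (A i * x powi i) * (case p of (j, k) \<Rightarrow> (A j * y powi j) * (A k * (x * y) powi k))) has_sum P) UNIV"
    unfolding P_def using norms le by (intro has_sum_mult inverse_K_has_sum) auto
  also have "?this \<longleftrightarrow> ((\<lambda>((m, n), k). A (m - k) * A (n - k) * A k * (x powi m * y powi n)) has_sum P) (UNIV \<times> UNIV)"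
  proof (rule has_sum_reindex_bij_witness[of _ "\<lambda>((m, n), k). (m - k, (n - k, k))" "\<lambda>(i, (j, k)). ((i + k, j + k), k)"], goal_cases)
    case (5 p)
    thus ?case
      using nz by (auto simp: power_int_add power_int_mult_distrib split: prod.splits)
  qed auto
  finally have "((\<lambda>(m, n). (\<Sum>\<^sub>\<infinity>k. A (m - k) * A (n - k) * A k) * (x powi m * y powi n)) has_sum P) UNIV"
    by (rule has_sum_SigmaD) (auto intro!: has_sum_cmult_left has_sum_infsum triple_summable)
  hence "((\<lambda>p. (case p of (m, n) \<Rightarrow> (\<Sum>\<^sub>\<infinity>k. A (m - k) * A (n - k) * A k) * (x powi m * y powi n)) / qpoch q q ^ 6)
            has_sum P / qpoch q q ^ 6) UNIV"
    by (rule has_sum_divide_const)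
  moreover have "P / qpoch q q ^ 6 = G_fun q (x, y)"
    using qpoch_q_q_nz nz
    by (simp add: P_def G_fun_def qpochs_def K_def field_simps flip: power_add)
  ultimately show "((\<lambda>(m, n). G_coeff (m, n) * x powi m * y powi n) has_sum G_fun q (x, y)) UNIV"
    by (simp add: G_coeff_def case_prod_unfold mult_ac)
qed

lemma laurent_expansion_G_unique:
  assumes "laurent_expansion_on (zeta_range q) (G_fun q) c"
  shows "c = G_coeff"
proof -
  \<comment> \<open>The torus |x| = |y| = r lies in \<open>zeta_range\<close> when |q| < r^2 and r <
    1; the arithmetic mean of 1 and |q| does both.\<close>
  define r where "r = (1 + norm q) / 2"
  have "norm q < r ^ 2"
  proof -
    have "r ^ 2 - norm q = ((1 - norm q) / 2) ^ 2"
      by (simp add: r_def power2_eq_square field_simps)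
    moreover have "((1 - norm q) / 2) ^ 2 > 0"
      using norm_q by simp
    ultimately show ?thesis
      by linarith
  qed
  moreover have r: "norm q < r" "r < 1" "r > 0"
    using norm_q by (simp_all add: r_def add_pos_nonneg)
  moreover have "r ^ 2 < 1"
    using r power_strict_mono[of r 1 2] by simp
  ultimately have range: "(x, y) \<in> zeta_range q" if "norm x = r" "norm y = r" for x y
    using that by (simp add: zeta_range_def norm_mult power2_eq_square)
  show ?thesis
  proof (rule Laurent_coeff2_unique[OF \<open>r > 0\<close>, where F = "\<lambda>x y. G_fun q (x, y)"])
    fix x y :: complex
    assume "norm x = r" "norm y = r"
    from range[OF this] assms laurent_expansion_G
    show "((\<lambda>(m, n). c (m, n) * x powi m * y powi n) has_sum G_fun q (x, y)) UNIV"
      "((\<lambda>(m, n). G_coeff (m, n) * x powi m * y powi n) has_sum G_fun q (x, y)) UNIV"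
      by (auto simp: laurent_expansion_on_def)
  qed
qed

lemma ex1_laurent_expansion_G: "\<exists>!c. laurent_expansion_on (zeta_range q) (G_fun q) c"
  using laurent_expansion_G laurent_expansion_G_unique by blast

lemma constant_term_G: "constant_term (zeta_range q) (G_fun q) = X / qpoch q q ^ 6"
proof -
  have "(THE c. laurent_expansion_on (zeta_range q) (G_fun q) c) = G_coeff"
    by (intro the_equality laurent_expansion_G laurent_expansion_G_unique)
  moreover have "(\<Sum>\<^sub>\<infinity>k. A (0 - k) * A (0 - k) * A k) = X"
    using A_cube_has_sum by (intro infsumI) (simp add: power3_eq_cube)
  ultimately show ?thesis
    by (simp add: constant_term_def G_coeff_def)
qed

end

subsection \<open>The false theta function\<close>

lemma q_powr_add: "q_powr \<tau> (a + b) = q_powr \<tau> a * q_powr \<tau> b"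
  by (simp add: q_powr_def algebra_simps flip: exp_add)

lemma q_powr_0 [simp]: "q_powr \<tau> 0 = 1"
  by (simp add: q_powr_def)

lemma q_powr_of_nat: "q_powr \<tau> (of_nat n) = q_of \<tau> ^ n"
  by (simp add: q_powr_def q_of_def mult_ac flip: exp_of_nat_mult)

lemma q_powr_of_int: "q_powr \<tau> (of_int n) = q_of \<tau> powi n"
proof (cases "n \<ge> 0")
  case True
  thus ?thesis
    using q_powr_of_nat[of \<tau> "nat n"] by (simp add: power_int_def)
next
  case False
  have "q_powr \<tau> (of_int n) * q_powr \<tau> (of_nat (nat (- n))) = 1"
    using False by (simp flip: q_powr_add)
  thus ?thesis
    using False unfolding q_powr_of_nat
    by (simp add: power_int_def inverse_unique mult.commute power_inverse)
qed

lemma norm_q_of: "norm (q_of \<tau>) = exp (- (2 * pi * Im \<tau>))"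
  by (simp add: q_of_def)

lemma nome_q_of: "Im \<tau> > 0 \<Longrightarrow> nome (q_of \<tau>)"
  by unfold_locales (simp add: norm_q_of, simp add: q_of_def)

lemma dedekind_eta_power:
  "dedekind_eta \<tau> ^ 6 = q_powr \<tau> (1 / 4) * qpoch (q_of \<tau>) (q_of \<tau>) ^ 6"
proof -
  have "q_powr \<tau> (1 / 24) ^ 6 = q_powr \<tau> (1 / 4)"
    by (simp add: q_powr_def mult_ac flip: exp_of_nat_mult)
  thus ?thesis
    by (simp add: dedekind_eta_def qpoch_def power_mult_distrib)
qed

lemma has_sum_shifted_int:
  "(f has_sum s) (shifted_int a) \<longleftrightarrow> ((\<lambda>k :: int. f (of_int k + a)) has_sum s) UNIV"
proof -
  have "shifted_int a = range (\<lambda>k :: int. of_int k + a)"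
    by (auto simp: shifted_int_def)
  thus ?thesis
    by (subst has_sum_reindex [symmetric, unfolded o_def]) (auto simp: inj_def)
qed

context nome
begin

text \<open>The summand of 9 q^(-1/3) \<open>Psi\<close> at (k + 1/3, l + 1/3): 9k + 3 is 9 (k +
  1/3), and k + 1/3 is positive exactly for k \<ge> 0 and never 0.\<close>

definition Y :: "int \<times> int \<Rightarrow> complex" where
  "Y = (\<lambda>(k, l). of_int ((if k \<ge> 0 then 1 else - 1) * (if l \<ge> 0 then 1 else - 1) * (9 * k + 3)) *
         q powi (k * k + k * l + l * l + k + l))"

lemma Y_eq:
  assumes "k * k + k * l + l * l + k + l = int N"
  shows "Y (k, l) = of_int ((if k \<ge> 0 then 1 else - 1) * (if l \<ge> 0 then 1 else - 1) * (9 * k + 3)) * q ^ N"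
  using assms by (simp only: Y_def prod.case power_int_of_nat)

text \<open>The column k = 0 of \<open>e\<close> is the one-dimensional series with exponent n^2 +
  n. Its removal matches the regions strictly beyond the antidiagonal.\<close>

lemma e_Suc_has_sum:
  "((\<lambda>(n, k). (a * of_nat n + b * of_nat (Suc k) + c) * e n (Suc k)) has_sum
      ((a + b) * E1 + c * E0 - (a * P1 + c * P0))) UNIV"
proof -
  define F where "F = (\<lambda>(n, k). (a * of_nat n + b * of_nat k + c) * e n k)"
  have F: "(F has_sum ((a + b) * E1 + c * E0)) UNIV"
    unfolding F_def by (rule e_has_sum)
  have "((\<lambda>n. F (n, 0)) has_sum (a * P1 + c * P0)) UNIV"
    using P_has_sum[of a c] by (simp add: F_def e_def)
  hence "(F has_sum (a * P1 + c * P0)) (range (\<lambda>n. (n, 0)))"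
    by (subst has_sum_reindex) (auto simp: inj_def o_def)
  from has_sum_Diff[OF F this]
  have "(F has_sum ((a + b) * E1 + c * E0 - (a * P1 + c * P0))) (UNIV - range (\<lambda>n. (n, 0)))"
    by simp
  also have "?this \<longleftrightarrow> ((\<lambda>(n, k). F (n, Suc k)) has_sum ((a + b) * E1 + c * E0 - (a * P1 + c * P0))) UNIV"
    by (rule has_sum_reindex_bij_witness[of _ "\<lambda>(n, k). (n, Suc k)" "\<lambda>(n, k). (n, k - 1)"])
       (auto simp: gr0_conv_Suc image_iff)
  finally show ?thesis
    by (simp add: F_def)
qed

text \<open>The two mixed quadrants are cut along the antidiagonal \<open>k + l = -1\<close>; on each half, a unimodular
  change of variables turns the exponent into that of \<open>e\<close> or \<open>f\<close>.\<close>

lemma Y_has_sum: "(Y has_sum (18 * E1 + 6 * E0 - (18 * F1 + 12 * F0))) UNIV"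
proof -
  have pp: "(Y has_sum (9 * E1 + 3 * E0)) {(k, l). k \<ge> 0 \<and> l \<ge> 0}"
  proof -
    have "((\<lambda>(n, k). (9 * of_nat n + 0 * of_nat k + 3) * e n k) has_sum ((9 + 0) * E1 + 3 * E0)) UNIV"
      by (rule e_has_sum)
    also have "?this \<longleftrightarrow> ?thesis"
    proof (rule has_sum_reindex_bij_witness[of _ "\<lambda>(k, l). (nat k, nat l)" "\<lambda>(n, k). (int n, int k)"], goal_cases)
      case (5 p)
      obtain n k where p: "p = (n, k)"
        by (cases p)
      show ?case
        unfolding p prod.case by (subst Y_eq[of _ _ "n * n + n * k + k * k + n + k"]) (auto simp: e_def)
    qed auto
    finally show ?thesis .
  qed
  have nn: "(Y has_sum - (9 * F1 + 6 * F0)) {(k, l). k < 0 \<and> l < 0}"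
  proof -
    have "((\<lambda>(n, k). (- 9 * of_nat n + 0 * of_nat k + (- 6)) * f n k) has_sum ((- 9 + 0) * F1 + (- 6) * F0)) UNIV"
      by (rule f_has_sum)
    also have "?this \<longleftrightarrow> ?thesis"
    proof (rule has_sum_reindex_bij_witness[of _ "\<lambda>(k, l). (nat (- k - 1), nat (- l - 1))"
             "\<lambda>(n, k). (- int n - 1, - int k - 1)"], goal_cases)
      case (5 p)
      obtain n k where p: "p = (n, k)"
        by (cases p)
      show ?case
        unfolding p prod.case
        by (subst Y_eq[of _ _ "n * n + n * k + k * k + 2 * n + 2 * k + 1"]) (auto simp: f_def algebra_simps)
    qed auto
    finally show ?thesis .
  qed
  \<comment> \<open>On k + l = -1 the exponent collapses to - k * l = k * (k + 1). All terms with
    \<open>P0\<close> and \<open>P1\<close> cancel in the end against those from \<open>pn2\<close>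
    and \<open>np2\<close>.\<close>
  have pn0: "(Y has_sum - (9 * P1 + 3 * P0)) {(k, l). k \<ge> 0 \<and> l = - k - 1}"
  proof -
    have "((\<lambda>n. (- 9 * of_nat n + (- 3)) * q ^ (n * n + n)) has_sum ((- 9) * P1 + (- 3) * P0)) UNIV"
      by (rule P_has_sum)
    also have "?this \<longleftrightarrow> ?thesis"
    proof (rule has_sum_reindex_bij_witness[of _ "\<lambda>(k, l). nat k" "\<lambda>n. (int n, - int n - 1)"], goal_cases)
      case (5 n)
      show ?case
        by (subst Y_eq[of _ _ "n * n + n"]) (auto simp: algebra_simps)
    qed auto
    finally show ?thesis .
  qed
  have np0: "(Y has_sum (9 * P1 + 6 * P0)) {(k, l). l \<ge> 0 \<and> k = - l - 1}"
  proof -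
    have "((\<lambda>n. (9 * of_nat n + 6) * q ^ (n * n + n)) has_sum (9 * P1 + 6 * P0)) UNIV"
      by (rule P_has_sum)
    also have "?this \<longleftrightarrow> ?thesis"
    proof (rule has_sum_reindex_bij_witness[of _ "\<lambda>(k, l). nat l" "\<lambda>n. (- int n - 1, int n)"], goal_cases)
      case (5 n)
      show ?case
        by (subst Y_eq[of _ _ "n * n + n"]) (auto simp: algebra_simps)
    qed auto
    finally show ?thesis .
  qed
  have pn1: "(Y has_sum - (18 * F1 + 12 * F0)) {(k, l). l < 0 \<and> k > - l - 1}"
  proof -
    have "((\<lambda>(n, k). (- 9 * of_nat n + (- 9) * of_nat k + (- 12)) * f n k) has_sum ((- 9 + (- 9)) * F1 + (- 12) * F0)) UNIV"
      by (rule f_has_sum)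
    also have "?this \<longleftrightarrow> ?thesis"
    proof (rule has_sum_reindex_bij_witness[of _ "\<lambda>(k, l). (nat (- l - 1), nat (k + l))"
             "\<lambda>(n, k). (int n + int k + 1, - int n - 1)"], goal_cases)
      case (5 p)
      obtain n k where p: "p = (n, k)"
        by (cases p)
      show ?case
        unfolding p prod.case
        by (subst Y_eq[of _ _ "n * n + n * k + k * k + 2 * n + 2 * k + 1"]) (auto simp: f_def algebra_simps)
    qed auto
    finally show ?thesis .
  qed
  have np1: "(Y has_sum (9 * F1 + 6 * F0)) {(k, l). k < 0 \<and> l > - k - 1}"
  proof -
    have "((\<lambda>(n, k). (9 * of_nat n + 0 * of_nat k + 6) * f n k) has_sum ((9 + 0) * F1 + 6 * F0)) UNIV"
      by (rule f_has_sum)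
    also have "?this \<longleftrightarrow> ?thesis"
    proof (rule has_sum_reindex_bij_witness[of _ "\<lambda>(k, l). (nat (- k - 1), nat (k + l))"
             "\<lambda>(n, k). (- int n - 1, int n + int k + 1)"], goal_cases)
      case (5 p)
      obtain n k where p: "p = (n, k)"
        by (cases p)
      show ?case
        unfolding p prod.case
        by (subst Y_eq[of _ _ "n * n + n * k + k * k + 2 * n + 2 * k + 1"]) (auto simp: f_def algebra_simps)
    qed auto
    finally show ?thesis .
  qed
  have pn2: "(Y has_sum (9 * P1 + 3 * P0 - (9 * E1 + 3 * E0))) {(k, l). k \<ge> 0 \<and> l < - k - 1}"
  proof -
    have "((\<lambda>(n, k). (- 9 * of_nat n + 0 * of_nat (Suc k) + (- 3)) * e n (Suc k)) has_sum
             ((- 9 + 0) * E1 + (- 3) * E0 - ((- 9) * P1 + (- 3) * P0))) UNIV"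
      by (rule e_Suc_has_sum)
    also have "?this \<longleftrightarrow> ?thesis"
    proof (rule has_sum_reindex_bij_witness[of _ "\<lambda>(k, l). (nat k, nat (- k - l - 2))"
             "\<lambda>(n, k). (int n, - int n - int k - 2)"], goal_cases)
      case (5 p)
      obtain n k where p: "p = (n, k)"
        by (cases p)
      show ?case
        unfolding p prod.case
        by (subst Y_eq[of _ _ "n * n + n * Suc k + Suc k * Suc k + n + Suc k"]) (auto simp: e_def algebra_simps)
    qed auto
    finally show ?thesis .
  qed
  have np2: "(Y has_sum (18 * E1 + 6 * E0 - (9 * P1 + 6 * P0))) {(k, l). l \<ge> 0 \<and> k < - l - 1}"
  proof -
    have "((\<lambda>(n, k). (9 * of_nat n + 9 * of_nat (Suc k) + 6) * e n (Suc k)) has_sum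
             ((9 + 9) * E1 + 6 * E0 - (9 * P1 + 6 * P0))) UNIV"
      by (rule e_Suc_has_sum)
    also have "?this \<longleftrightarrow> ?thesis"
    proof (rule has_sum_reindex_bij_witness[of _ "\<lambda>(k, l). (nat l, nat (- k - l - 2))"
             "\<lambda>(n, k). (- int n - int k - 2, int n)"], goal_cases)
      case (5 p)
      obtain n k where p: "p = (n, k)"
        by (cases p)
      show ?case
        unfolding p prod.case
        by (subst Y_eq[of _ _ "n * n + n * Suc k + Suc k * Suc k + n + Suc k"]) (auto simp: e_def algebra_simps)
    qed auto
    finally show ?thesis .
  qed
  note regions = pp nn pn0 np0 pn1 np1 pn2 np2
  have "(Y has_sum ((9 * E1 + 3 * E0) + - (9 * F1 + 6 * F0) + - (9 * P1 + 3 * P0) + (9 * P1 + 6 * P0) +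
           - (18 * F1 + 12 * F0) + (9 * F1 + 6 * F0) + (9 * P1 + 3 * P0 - (9 * E1 + 3 * E0)) +
           (18 * E1 + 6 * E0 - (9 * P1 + 6 * P0))))
          ({(k, l). k \<ge> 0 \<and> l \<ge> 0} \<union> {(k, l). k < 0 \<and> l < 0} \<union> {(k, l). k \<ge> 0 \<and> l = - k - 1} \<union>
           {(k, l). l \<ge> 0 \<and> k = - l - 1} \<union> {(k, l). l < 0 \<and> k > - l - 1} \<union>
           {(k, l). k < 0 \<and> l > - k - 1} \<union> {(k, l). k \<ge> 0 \<and> l < - k - 1} \<union>
           {(k, l). l \<ge> 0 \<and> k < - l - 1})"
    by (intro has_sum_Un_disjoint regions) auto
  moreover have "{(k, l). k \<ge> 0 \<and> l \<ge> 0} \<union> {(k, l). k < 0 \<and> l < 0} \<union> {(k, l). k \<ge> 0 \<and> l = - k - 1} \<union>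
           {(k, l). l \<ge> 0 \<and> k = - l - 1} \<union> {(k, l). l < 0 \<and> k > - l - 1} \<union>
           {(k, l). k < 0 \<and> l > - k - 1} \<union> {(k, l). k \<ge> 0 \<and> l < - k - 1} \<union>
           {(k, l). l \<ge> 0 \<and> k < - l - 1} = (UNIV :: (int \<times> int) set)"
    by auto
  ultimately show ?thesis
    by (simp add: algebra_simps)
qed

end

lemma Psi_eq:
  assumes "Im \<tau> > 0"
  defines "q \<equiv> q_of \<tau>"
  shows "9 * q_powr \<tau> (- 1 / 3) * Psi \<tau> =
           18 * nome.E1 q + 6 * nome.E0 q - (18 * nome.F1 q + 12 * nome.F0 q)" (is "_ = ?S")
proof -
  interpret nome q
    unfolding q_def using assms(1) by (rule nome_q_of)
  define F where "F = (\<lambda>(x, y). of_real (sgn x * sgn y * x) * q_powr \<tau> (Q_A x y))"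
  have F: "F (of_int k + 1 / 3, of_int l + 1 / 3) = q_powr \<tau> (1 / 3) / 9 * Y (k, l)" for k l
  proof -
    have sgn: "sgn (of_int k + 1 / 3 :: real) = (if k \<ge> 0 then 1 else - 1)" for k :: int
    proof (cases "k \<ge> 0")
      case False
      hence "real_of_int k \<le> - 1"
        by linarith
      thus ?thesis
        using False by (simp add: sgn_if)
    qed (auto simp: sgn_if)
    have "Q_A (of_int k + 1 / 3) (of_int l + 1 / 3) = of_int (k * k + k * l + l * l + k + l) + 1 / 3"
      by (simp add: Q_A_def power2_eq_square field_simps)
    hence "q_powr \<tau> (Q_A (of_int k + 1 / 3) (of_int l + 1 / 3)) =
             q powi (k * k + k * l + l * l + k + l) * q_powr \<tau> (1 / 3)"
      by (simp only: q_powr_add q_powr_of_int q_def)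
    thus ?thesis
      unfolding F_def prod.case sgn by (simp add: Y_def field_simps)
  qed
  have "((\<lambda>p. q_powr \<tau> (1 / 3) / 9 * Y p) has_sum (q_powr \<tau> (1 / 3) / 9 * ?S)) UNIV"
    by (intro has_sum_cmult_right Y_has_sum)
  also have "?this \<longleftrightarrow> (F has_sum (q_powr \<tau> (1 / 3) / 9 * ?S)) (shifted_int (1 / 3) \<times> shifted_int (1 / 3))"
    by (rule has_sum_reindex_bij_witness[of _ "\<lambda>(x, y). (\<lfloor>x\<rfloor>, \<lfloor>y\<rfloor>)" "\<lambda>(k, l). (of_int k + 1 / 3, of_int l + 1 / 3)"])
       (auto simp: shifted_int_def F)
  finally have "Psi \<tau> = q_powr \<tau> (1 / 3) / 9 * ?S"
    unfolding Psi_def F_def by (rule infsumI)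
  moreover have "q_powr \<tau> (- 1 / 3) * q_powr \<tau> (1 / 3) = 1"
    by (simp flip: q_powr_add)
  hence "9 * q_powr \<tau> (- 1 / 3) * (q_powr \<tau> (1 / 3) / 9 * ?S) = ?S"
    by (simp flip: mult.assoc)
  ultimately show ?thesis
    by (simp only:)
qed

lemma G0_eq:
  assumes "Im \<tau> > 0"
  defines "q \<equiv> q_of \<tau>"
  shows "G0 \<tau> = 1 + 6 * (nome.R1 q + nome.R0 q) - 6 * (2 * nome.P1 q + nome.P0 q)"
proof -
  interpret nome q
    unfolding q_def using assms(1) by (rule nome_q_of)
  have "((\<lambda>n. of_real \<bar>n\<bar> * q_powr \<tau> (n\<^sup>2)) has_sum ((R1 + R0) + (R1 + R0))) (shifted_int 0)"
    unfolding has_sum_shifted_int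
  proof (rule has_sum_int_split)
    have Suc: "of_real \<bar>real (Suc n)\<bar> * q_powr \<tau> ((real (Suc n))\<^sup>2) = (1 * of_nat n + 1) * q ^ (Suc n * Suc n)" for n
    proof -
      have "(real (Suc n))\<^sup>2 = real (Suc n * Suc n)"
        by (simp only: power2_eq_square of_nat_mult)
      thus ?thesis
        unfolding q_def by (simp only: q_powr_of_nat) simp
    qed
    have R: "((\<lambda>n. of_real \<bar>real (Suc n)\<bar> * q_powr \<tau> ((real (Suc n))\<^sup>2)) has_sum (R1 + R0)) UNIV"
      unfolding Suc using R_has_sum[of 1 1] by simp
    show "((\<lambda>n. of_real \<bar>of_int (int n) + 0\<bar> * q_powr \<tau> ((of_int (int n) + 0)\<^sup>2)) has_sum (R1 + R0)) UNIV"
      using has_sum_Suc_iff[THEN iffD1, OF R] by simp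
    have "\<bar>real_of_int (- int n - 1) + 0\<bar> = real (Suc n)" "(real_of_int (- int n - 1) + 0)\<^sup>2 = (real (Suc n))\<^sup>2" for n
      by (simp_all add: power2_eq_square algebra_simps)
    thus "((\<lambda>n. of_real \<bar>of_int (- int n - 1) + 0\<bar> * q_powr \<tau> ((of_int (- int n - 1) + 0)\<^sup>2)) has_sum (R1 + R0)) UNIV"
      using R by simp
  qed
  moreover have "((\<lambda>n. of_real \<bar>n\<bar> * q_powr \<tau> (n\<^sup>2)) has_sum
      (q_powr \<tau> (1 / 4) * (P1 + 1 / 2 * P0) + q_powr \<tau> (1 / 4) * (P1 + 1 / 2 * P0))) (shifted_int (1 / 2))"
    unfolding has_sum_shifted_int
  proof (rule has_sum_int_split)
    have "of_real \<bar>real n + 1 / 2\<bar> * q_powr \<tau> ((real n + 1 / 2)\<^sup>2) =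
            q_powr \<tau> (1 / 4) * ((1 * of_nat n + 1 / 2) * q ^ (n * n + n))" for n
    proof -
      have "(real n + 1 / 2)\<^sup>2 = real (n * n + n) + 1 / 4"
        by (simp add: power2_eq_square field_simps)
      hence "q_powr \<tau> ((real n + 1 / 2)\<^sup>2) = q ^ (n * n + n) * q_powr \<tau> (1 / 4)"
        by (simp only: q_powr_add q_powr_of_nat q_def)
      thus ?thesis
        by simp
    qed
    moreover have "((\<lambda>n. q_powr \<tau> (1 / 4) * ((1 * of_nat n + 1 / 2) * q ^ (n * n + n))) has_sum
                     q_powr \<tau> (1 / 4) * (1 * P1 + 1 / 2 * P0)) UNIV"
      by (intro has_sum_cmult_right P_has_sum)
    ultimately have P: "((\<lambda>n. of_real \<bar>real n + 1 / 2\<bar> * q_powr \<tau> ((real n + 1 / 2)\<^sup>2)) has_sum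
        q_powr \<tau> (1 / 4) * (P1 + 1 / 2 * P0)) UNIV"
      by (simp only: mult_1_left)
    thus "((\<lambda>n. of_real \<bar>of_int (int n) + 1 / 2\<bar> * q_powr \<tau> ((of_int (int n) + 1 / 2)\<^sup>2)) has_sum
        q_powr \<tau> (1 / 4) * (P1 + 1 / 2 * P0)) UNIV"
      by simp
    have "\<bar>real_of_int (- int n - 1) + 1 / 2\<bar> = \<bar>real n + 1 / 2\<bar>"
       "(real_of_int (- int n - 1) + 1 / 2)\<^sup>2 = (real n + 1 / 2)\<^sup>2" for n
      by (simp_all add: power2_eq_square field_simps)
    thus "((\<lambda>n. of_real \<bar>of_int (- int n - 1) + 1 / 2\<bar> * q_powr \<tau> ((of_int (- int n - 1) + 1 / 2)\<^sup>2)) has_sum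
        q_powr \<tau> (1 / 4) * (P1 + 1 / 2 * P0)) UNIV"
      using P by (simp only:)
  qed
  moreover have "q_powr \<tau> (- 1 / 4) * q_powr \<tau> (1 / 4) = 1"
    by (simp flip: q_powr_add)
  ultimately show ?thesis
    unfolding G0_def by (simp add: infsumI algebra_simps)
qed

lemma constant_term_eq:
  assumes "Im \<tau> > 0"
  shows "constant_term (zeta_range (q_of \<tau>)) (G_fun (q_of \<tau>)) =
           q_powr \<tau> (1/4) / dedekind_eta \<tau> ^ 6 * G0 \<tau> + 9 * q_powr \<tau> (-1/12) / dedekind_eta \<tau> ^ 6 * Psi \<tau>"
proof -
  interpret nome "q_of \<tau>"
    using assms by (rule nome_q_of)
  have "q_powr \<tau> (- 1 / 12) = q_powr \<tau> (1 / 4) * q_powr \<tau> (- 1 / 3)"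
    by (simp flip: q_powr_add)
  moreover have "q_powr \<tau> (1 / 4) \<noteq> 0"
    by (simp add: q_powr_def)
  ultimately have "q_powr \<tau> (1/4) / dedekind_eta \<tau> ^ 6 * G0 \<tau> + 9 * q_powr \<tau> (-1/12) / dedekind_eta \<tau> ^ 6 * Psi \<tau> =
      (G0 \<tau> + 9 * q_powr \<tau> (- 1 / 3) * Psi \<tau>) / qpoch (q_of \<tau>) (q_of \<tau>) ^ 6"
    using qpoch_q_q_nz by (simp add: dedekind_eta_power field_simps)
  also have "G0 \<tau> + 9 * q_powr \<tau> (- 1 / 3) * Psi \<tau> = X"
    unfolding G0_eq[OF assms] Psi_eq[OF assms] X_def by simp
  finally show ?thesis
    by (simp add: constant_term_G)
qed

subsection \<open>The first coefficients\<close>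

text \<open>Summability at the single point 1/2 controls the tail uniformly for |q| \<le> 1/2:
  outside J the power |q|^(d i) is at most |q|^N (1/2)^(d i - N).\<close>

lemma power_infsum_truncate:
  fixes c :: "'a \<Rightarrow> complex"
  assumes J: "finite J" "\<And>i. i \<notin> J \<Longrightarrow> N \<le> d i"
    and summ: "(\<lambda>i. c i * (1 / 2) ^ d i) summable_on UNIV"
  shows "(\<lambda>q. (\<Sum>\<^sub>\<infinity>i. c i * q ^ d i) - (\<Sum>i\<in>J. c i * q ^ d i)) \<in> O[at 0](\<lambda>q. q ^ N)"
proof -
  have summ': "(\<lambda>i. norm (c i) * (1 / 2) ^ d i) summable_on UNIV"
    using summ by (subst (asm) summable_on_iff_abs_summable_on_complex) (simp add: norm_mult norm_power norm_divide)
  define S where "S = (\<Sum>\<^sub>\<infinity>i\<in>-J. norm (c i) * (1 / 2) ^ d i)"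
  have S: "((\<lambda>i. norm (c i) * (1 / 2) ^ d i) has_sum S) (- J)"
    unfolding S_def using summ' by (intro has_sum_infsum) (rule summable_on_subset_banach, auto)
  have bound: "norm ((\<Sum>\<^sub>\<infinity>i. c i * q ^ d i) - (\<Sum>i\<in>J. c i * q ^ d i)) \<le> S * 2 ^ N * norm (q ^ N)"
    if q: "norm q \<le> 1 / 2" for q
  proof (rule norm_infsum_le)
    have "(\<lambda>i. c i * q ^ d i) summable_on UNIV"
      using q by (intro summable_on_complex_comparison[OF summ'])
         (auto simp: norm_mult norm_power intro!: mult_left_mono power_mono)
    hence "((\<lambda>i. c i * q ^ d i) has_sum ((\<Sum>\<^sub>\<infinity>i. c i * q ^ d i) - (\<Sum>i\<in>J. c i * q ^ d i))) (UNIV - J)"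
      using J(1) by (intro has_sum_Diff has_sum_infsum has_sum_finite) auto
    thus "((\<lambda>i. c i * q ^ d i) has_sum ((\<Sum>\<^sub>\<infinity>i. c i * q ^ d i) - (\<Sum>i\<in>J. c i * q ^ d i))) (- J)"
      by (simp add: Compl_eq_Diff_UNIV)
    show "((\<lambda>i. norm (c i) * (1 / 2) ^ d i * 2 ^ N * norm (q ^ N)) has_sum (S * 2 ^ N * norm (q ^ N))) (- J)"
      by (intro has_sum_cmult_left S)
    fix i assume "i \<in> - J"
    then obtain m where m: "d i = m + N"
      using J(2)[of i] by (metis ComplD le_add_diff_inverse2)
    have "norm q ^ m * norm q ^ N \<le> (1 / 2) ^ m * norm q ^ N"
      using q by (intro mult_right_mono power_mono) auto
    also have "\<dots> = (1 / 2) ^ d i * 2 ^ N * norm (q ^ N)"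
      by (simp add: m power_add norm_power power_one_over)
    finally have "norm (c i) * (norm q ^ m * norm q ^ N) \<le> norm (c i) * ((1 / 2) ^ d i * 2 ^ N * norm (q ^ N))"
      by (intro mult_left_mono) auto
    thus "norm (c i * q ^ d i) \<le> norm (c i) * (1 / 2) ^ d i * 2 ^ N * norm (q ^ N)"
      by (simp add: m norm_mult norm_power power_add mult_ac)
  qed
  have "eventually (\<lambda>q :: complex. norm q \<le> 1 / 2) (at 0)"
    by (rule eventually_at_le[THEN iffD2]) (auto intro!: exI[of _ "1 / 2"])
  hence "eventually (\<lambda>q. norm ((\<Sum>\<^sub>\<infinity>i. c i * q ^ d i) - (\<Sum>i\<in>J. c i * q ^ d i)) \<le> S * 2 ^ N * norm (q ^ N)) (at 0)"
    by eventually_elim (rule bound)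
  thus ?thesis
    by (rule bigoI)
qed

section \<open>Error terms as q tends to 0\<close>

lemma bigo_diff_mult:
  fixes f g f' g' :: "'a \<Rightarrow> complex"
  assumes "(\<lambda>x. f x - g x) \<in> O[F](h)" "(\<lambda>x. f' x - g' x) \<in> O[F](h)"
    and "f \<in> O[F](\<lambda>_. 1)" "g' \<in> O[F](\<lambda>_. 1)"
  shows "(\<lambda>x. f x * f' x - g x * g' x) \<in> O[F](h)"
proof -
  have "(\<lambda>x. f x * (f' x - g' x)) \<in> O[F](\<lambda>x. 1 * h x)" "(\<lambda>x. g' x * (f x - g x)) \<in> O[F](\<lambda>x. 1 * h x)"
    by (intro landau_o.big.mult assms)+
  hence "(\<lambda>x. f x * (f' x - g' x) + g' x * (f x - g x)) \<in> O[F](h)"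
    by (intro sum_in_bigo) auto
  thus ?thesis
    by (simp add: algebra_simps)
qed

lemma isCont_bigo_1:
  fixes f :: "complex \<Rightarrow> complex"
  assumes "isCont f 0"
  shows "f \<in> O[at 0](\<lambda>_. 1)"
  using assms unfolding isCont_def by (intro bigoI_tendsto[where c = "f 0"]) auto

lemma power_mult_bigo:
  fixes f :: "complex \<Rightarrow> complex"
  assumes "isCont f 0"
  shows "(\<lambda>q. q ^ n * f q) \<in> O[at 0](\<lambda>q. q ^ n)"
  using landau_o.big.mult[OF landau_o.big_refl isCont_bigo_1[OF assms], of "\<lambda>q. q ^ n"] by simp

context nome
begin

lemma qpoch_split: "qpoch a q = (\<Prod>j<n. 1 - a * q ^ j) * qpoch (a * q ^ n) q"
proof (induction n)
  case (Suc n)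
  show ?case
    using Suc qpoch_rec[of "a * q ^ n"] by (simp add: mult_ac)
qed auto

lemma norm_euler_coeff_le:
  assumes "norm q \<le> 1 / 2"
  shows "norm (euler_coeff i) \<le> 2 ^ i"
proof (induction i)
  case (Suc i)
  have "norm (q ^ Suc i) \<le> norm q ^ 1"
    by (rule norm_q_power_le) simp
  hence 1: "1 / 2 \<le> norm (1 - q ^ Suc i)"
    using assms norm_triangle_ineq2[of 1 "q ^ Suc i"] by simp
  have "norm (q ^ i * euler_coeff i) \<le> 1 * 2 ^ i"
    unfolding norm_mult using Suc norm_q by (intro mult_mono) (auto simp: norm_power power_le_one)
  hence "norm (q ^ i * euler_coeff i) / norm (1 - q ^ Suc i) \<le> (1 * 2 ^ i) / (1 / 2)"
    using 1 by (intro frac_le) auto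
  thus ?case
    by (simp add: norm_divide)
qed auto

text \<open>The bound is uniform in q, as it is applied with z = q^10 while q varies. Bounding
  Euler's coefficients by 2^i leaves a geometric series of ratio 2 |z| \<le> 1/2.\<close>

lemma norm_qpoch_minus_1_le:
  assumes "norm q \<le> 1 / 2" "norm z \<le> 1 / 4"
  shows "norm (qpoch z q - 1) \<le> 4 * norm z"
proof (rule norm_infsum_le)
  have "((\<lambda>i. euler_coeff i * z ^ i) has_sum (euler_coeff 0 * z ^ 0 + (qpoch z q - 1))) UNIV"
    using euler_has_sum[of z] by simp
  thus "((\<lambda>i. euler_coeff (Suc i) * z ^ Suc i) has_sum (qpoch z q - 1)) UNIV"
    by (subst has_sum_Suc_iff[where f = "\<lambda>i. euler_coeff i * z ^ i"])
  have "(\<lambda>i. (1 / 2) ^ i) sums (1 / (1 - 1 / 2) :: real)"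
    by (rule geometric_sums) auto
  hence "((\<lambda>i. (1 / 2) ^ i) has_sum (2 :: real)) UNIV"
    by (intro norm_summable_imp_has_sum) (auto intro!: summable_geometric)
  from has_sum_cmult_right[OF this, of "2 * norm z"]
  show "((\<lambda>i. 2 * norm z * (1 / 2) ^ i) has_sum (4 * norm z)) UNIV"
    by simp
  fix i :: nat
  have "norm (euler_coeff (Suc i) * z ^ Suc i) \<le> 2 ^ Suc i * norm z ^ Suc i"
    unfolding norm_mult norm_power by (intro mult_right_mono norm_euler_coeff_le assms) auto
  also have "\<dots> = 2 * norm z * (2 * norm z) ^ i"
    by (simp add: power_mult_distrib)
  also have "\<dots> \<le> 2 * norm z * (1 / 2) ^ i"
    using assms by (intro mult_left_mono power_mono) auto
  finally show "norm (euler_coeff (Suc i) * z ^ Suc i) \<le> 2 * norm z * (1 / 2) ^ i" .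
qed

text \<open>Coefficients independent of q are required for truncation; by symmetry the weights in
  the double series can be placed on n alone.\<close>

lemma X_series:
  "X = 1 + (\<Sum>\<^sub>\<infinity>n. (6 * of_nat n + 6) * q ^ (Suc n * Suc n)) - (\<Sum>\<^sub>\<infinity>n. (12 * of_nat n + 6) * q ^ (n * n + n))
      + (\<Sum>\<^sub>\<infinity>p. (case p of (n, k) \<Rightarrow> 18 * of_nat n + 6) * q ^ (case p of (n, k) \<Rightarrow> n * n + n * k + k * k + n + k))
      - (\<Sum>\<^sub>\<infinity>p. (case p of (n, k) \<Rightarrow> 18 * of_nat n + 12) *
           q ^ (case p of (n, k) \<Rightarrow> n * n + n * k + k * k + 2 * n + 2 * k + 1))"
  using R_has_sum[of 6 6, THEN infsumI] P_has_sum[of 12 6, THEN infsumI]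
    e_has_sum[of 18 0 6, THEN infsumI] f_has_sum[of 18 0 12, THEN infsumI]
  by (simp add: X_def e_def f_def case_prod_unfold)

end

lemma eventually_nome: "eventually nome (at 0)"
proof -
  have "eventually (\<lambda>q :: complex. norm q < 1) (nhds 0)"
    by (rule eventually_nhds_metric[THEN iffD2]) (auto intro!: exI[of _ 1])
  hence "eventually (\<lambda>q :: complex. norm q < 1) (at 0)"
    by (simp add: eventually_at_filter eventually_mono)
  moreover have "eventually (\<lambda>q :: complex. q \<noteq> 0) (at 0)"
    by (rule eventually_neq_at_within)
  ultimately show ?thesis
    by eventually_elim (unfold_locales, auto)
qed

lemma X_truncate:
  "(\<lambda>q. nome.X q - (1 - 6 * q + 12 * q ^ 2 - 30 * q ^ 4 + 24 * q ^ 5 + 18 * q ^ 6 - 30 * q ^ 8 - 42 * q ^ 9))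
     \<in> O[at 0](\<lambda>q. q ^ 10)"
proof -
  interpret half: nome "1 / 2"
    by unfold_locales (auto simp: norm_divide)
  \<comment> \<open>The pairs whose exponent in \<open>e\<close> is below 10. The exponent in
    \<open>f\<close> is larger by n + k + 1, so the same set serves both.\<close>
  define J :: "(nat \<times> nat) set" where "J = {(0, 0), (0, 1), (1, 0), (1, 1), (0, 2), (2, 0)}"
  have ge: "10 \<le> n * n + n * k + k * k + n + k" if "(n, k) \<notin> J" for n k :: nat
  proof (cases "n \<ge> 3 \<or> k \<ge> 3")
    case True
    hence "3 * 3 \<le> n * n \<and> n \<ge> 3 \<or> 3 * 3 \<le> k * k \<and> k \<ge> 3"
      using mult_le_mono by blast
    thus ?thesis
      by linarith
  next
    case False
    hence "n \<in> {0, 1, 2}" "k \<in> {0, 1, 2}"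
      by auto
    thus ?thesis
      using that by (auto simp: J_def)
  qed
  have three: "n \<ge> 3 \<Longrightarrow> 10 \<le> n * n + n" for n :: nat
    using mult_le_mono[of 3 n 3 n] by linarith
  have R: "(\<lambda>q :: complex. (\<Sum>\<^sub>\<infinity>n. (6 * of_nat n + 6) * q ^ (Suc n * Suc n)) -
             (\<Sum>n\<in>{..<3}. (6 * of_nat n + 6) * q ^ (Suc n * Suc n))) \<in> O[at 0](\<lambda>q. q ^ 10)"
  proof (rule power_infsum_truncate)
    show "10 \<le> Suc n * Suc n" if "n \<notin> {..<3}" for n
      using three[of n] that by simp
    show "(\<lambda>n. (6 * of_nat n + 6) * (1 / 2) ^ (Suc n * Suc n) :: complex) summable_on UNIV"
      by (rule has_sum_imp_summable[OF half.R_has_sum])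
  qed auto
  have P: "(\<lambda>q :: complex. (\<Sum>\<^sub>\<infinity>n. (12 * of_nat n + 6) * q ^ (n * n + n)) -
             (\<Sum>n\<in>{..<3}. (12 * of_nat n + 6) * q ^ (n * n + n))) \<in> O[at 0](\<lambda>q. q ^ 10)"
  proof (rule power_infsum_truncate)
    show "10 \<le> n * n + n" if "n \<notin> {..<3}" for n :: nat
      using three[of n] that by simp
    show "(\<lambda>n. (12 * of_nat n + 6) * (1 / 2) ^ (n * n + n) :: complex) summable_on UNIV"
      by (rule has_sum_imp_summable[OF half.P_has_sum])
  qed auto
  have E: "(\<lambda>q :: complex. (\<Sum>\<^sub>\<infinity>p. (case p of (n, k) \<Rightarrow> 18 * of_nat n + 6) * q ^ (case p of (n, k) \<Rightarrow> n * n + n * k + k * k + n + k)) -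
             (\<Sum>p\<in>J. (case p of (n, k) \<Rightarrow> 18 * of_nat n + 6) * q ^ (case p of (n, k) \<Rightarrow> n * n + n * k + k * k + n + k)))
             \<in> O[at 0](\<lambda>q. q ^ 10)"
  proof (rule power_infsum_truncate)
    show "finite J"
      by (simp add: J_def)
    show "10 \<le> (case p of (n, k) \<Rightarrow> n * n + n * k + k * k + n + k)" if "p \<notin> J" for p
      using ge that by (cases p) auto
    show "(\<lambda>p. (case p of (n, k) \<Rightarrow> 18 * of_nat n + 6) *
            (1 / 2) ^ (case p of (n, k) \<Rightarrow> n * n + n * k + k * k + n + k) :: complex) summable_on UNIV"
      using half.e_has_sum[of 18 0 6] by (auto simp: summable_on_def half.e_def case_prod_unfold)
  qed
  have F: "(\<lambda>q :: complex. (\<Sum>\<^sub>\<infinity>p. (case p of (n, k) \<Rightarrow> 18 * of_nat n + 12) * q ^ (case p of (n, k) \<Rightarrow> n * n + n * k + k * k + 2 * n + 2 * k + 1)) -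
             (\<Sum>p\<in>J. (case p of (n, k) \<Rightarrow> 18 * of_nat n + 12) * q ^ (case p of (n, k) \<Rightarrow> n * n + n * k + k * k + 2 * n + 2 * k + 1)))
             \<in> O[at 0](\<lambda>q. q ^ 10)"
  proof (rule power_infsum_truncate)
    show "finite J"
      by (simp add: J_def)
    show "10 \<le> (case p of (n, k) \<Rightarrow> n * n + n * k + k * k + 2 * n + 2 * k + 1)" if "p \<notin> J" for p
    proof (cases p)
      case (Pair n k)
      thus ?thesis
        using ge[of n k] that by simp
    qed
    show "(\<lambda>p. (case p of (n, k) \<Rightarrow> 18 * of_nat n + 12) *
            (1 / 2) ^ (case p of (n, k) \<Rightarrow> n * n + n * k + k * k + 2 * n + 2 * k + 1) :: complex) summable_on UNIV"
      using half.f_has_sum[of 18 0 12] by (auto simp: summable_on_def half.f_def case_prod_unfold)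
  qed
  have sums:
    "(\<Sum>n\<in>{..<3}. (6 * of_nat n + 6) * q ^ (Suc n * Suc n)) = 6 * q + 12 * q ^ 4 + 18 * q ^ 9"
    "(\<Sum>n\<in>{..<3}. (12 * of_nat n + 6) * q ^ (n * n + n)) = 6 + 18 * q ^ 2 + 30 * q ^ 6"
    "(\<Sum>p\<in>J. (case p of (n, k) \<Rightarrow> 18 * of_nat n + 6) * q ^ (case p of (n, k) \<Rightarrow> n * n + n * k + k * k + n + k)) =
       6 + 30 * q ^ 2 + 24 * q ^ 5 + 48 * q ^ 6"
    "(\<Sum>p\<in>J. (case p of (n, k) \<Rightarrow> 18 * of_nat n + 12) * q ^ (case p of (n, k) \<Rightarrow> n * n + n * k + k * k + 2 * n + 2 * k + 1)) =
       12 * q + 42 * q ^ 4 + 30 * q ^ 8 + 60 * q ^ 9" for q :: complex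
    by (simp_all add: J_def lessThan_nat_numeral) (simp_all add: eval_nat_numeral)
  note RPEF = sum_in_bigo(2)[OF sum_in_bigo(1)[OF sum_in_bigo(2)[OF R P] E] F]
  show ?thesis
    by (rule landau_o.big.in_cong[THEN iffD1, OF eventually_mono[OF eventually_nome] RPEF])
       (simp only: nome.X_series sums, algebra)
qed

text \<open>The main term starts Euler's pentagonal number series, whose next exponents are 12 and
  15. It comes from the nine factors 1 - q^j with 1 \<le> j \<le> 9; the others form
  \<open>qpoch (q * q ^ 9) q\<close>, which is 1 + O(q^10).\<close>

lemma qpoch_truncate: "(\<lambda>q. qpoch q q - (1 - q - q ^ 2 + q ^ 5 + q ^ 7)) \<in> O[at 0](\<lambda>q. q ^ 10)"
proof -
  define u where "u q = (\<Prod>j<9. 1 - q * q ^ j)" for q :: complex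
  \<comment> \<open>The quotient by q^10 of the high-order part of the polynomial u, which has
    degree 45.\<close>
  define s where "s q = 1 - 2 * q^2 - q^3 - q^4 - q^5 + q^7 + q^8 + q^9 + 2 * q^10 + q^11 + q^12 - q^13 - q^14
    - 2 * q^15 - q^16 - q^17 - q^18 + q^20 + q^21 + q^22 + 2 * q^23 - q^25 - q^28 - q^30 + q^33 + q^34 - q^35" for q :: complex
  have u: "u q - (1 - q - q ^ 2 + q ^ 5 + q ^ 7) = q ^ 10 * s q" for q
    unfolding u_def s_def by (simp add: eval_nat_numeral) algebra
  have "(\<lambda>q. qpoch (q * q ^ 9) q - 1) \<in> O[at 0](\<lambda>q. q ^ 10)"
  proof (rule bigoI)
    have "eventually (\<lambda>q :: complex. norm q \<le> 1 / 2) (at 0)"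
      by (rule eventually_at_le[THEN iffD2]) (auto intro!: exI[of _ "1 / 2"])
    with eventually_nome show "\<forall>\<^sub>F q in at 0. norm (qpoch (q * q ^ 9) q - 1) \<le> 4 * norm (q ^ 10)"
    proof eventually_elim
      case (elim q)
      have "norm (q ^ 10) \<le> (1 / 2) ^ 10"
        unfolding norm_power using elim by (intro power_mono) auto
      also have "(1 / 2) ^ 10 \<le> (1 / 4 :: real)"
        by (simp add: power_one_over)
      finally have "norm (q * q ^ 9) \<le> 1 / 4"
        by (simp flip: power_Suc)
      from nome.norm_qpoch_minus_1_le[OF elim this] show ?case
        by (simp flip: power_Suc)
    qed
  qed
  hence "(\<lambda>q. u q * (qpoch (q * q ^ 9) q - 1)) \<in> O[at 0](\<lambda>q. 1 * q ^ 10)"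
    by (intro landau_o.big.mult isCont_bigo_1) (auto simp: u_def intro!: continuous_intros)
  moreover have "(\<lambda>q. u q - (1 - q - q ^ 2 + q ^ 5 + q ^ 7)) \<in> O[at 0](\<lambda>q. q ^ 10)"
    unfolding u s_def by (intro power_mult_bigo continuous_intros)
  ultimately have "(\<lambda>q. u q * (qpoch (q * q ^ 9) q - 1) + (u q - (1 - q - q ^ 2 + q ^ 5 + q ^ 7))) \<in> O[at 0](\<lambda>q. q ^ 10)"
    unfolding mult_1_left by (rule sum_in_bigo(1))
  also have "?this \<longleftrightarrow> ?thesis"
  proof (rule landau_o.big.in_cong)
    show "\<forall>\<^sub>F q in at 0. u q * (qpoch (q * q ^ 9) q - 1) + (u q - (1 - q - q ^ 2 + q ^ 5 + q ^ 7)) =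
            qpoch q q - (1 - q - q ^ 2 + q ^ 5 + q ^ 7)"
      using eventually_nome
    proof eventually_elim
      case (elim q)
      have "qpoch q q = u q * qpoch (q * q ^ 9) q"
        unfolding u_def by (rule nome.qpoch_split[OF elim])
      thus ?case
        by (simp add: right_diff_distrib)
    qed
  qed
  finally show ?thesis .
qed

text \<open>Checking that \<open>X\<close> agrees with P * E^6 up to O(q^10) replaces power series
  division by multiplication; dividing afterwards keeps the order of the error because E^6 tends to
  1.\<close>

lemma X_quotient_truncate:
  "(\<lambda>q. nome.X q / qpoch q q ^ 6 - (1 + 3 * q ^ 2 + 8 * q ^ 3 + 21 * q ^ 4 + 48 * q ^ 5 + 116 * q ^ 6
      + 252 * q ^ 7 + 555 * q ^ 8 + 1156 * q ^ 9)) \<in> O[at 0](\<lambda>q. q ^ 10)"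
proof -
  define P X0 where "P q = 1 + 3 * q ^ 2 + 8 * q ^ 3 + 21 * q ^ 4 + 48 * q ^ 5 + 116 * q ^ 6
      + 252 * q ^ 7 + 555 * q ^ 8 + 1156 * q ^ 9"
    and "X0 q = 1 - 6 * q + 12 * q ^ 2 - 30 * q ^ 4 + 24 * q ^ 5 + 18 * q ^ 6 - 30 * q ^ 8 - 42 * q ^ 9" for q :: complex
  \<comment> \<open>Truncations of the powers 1, 2, 4, 6 of E at order q^10; the s polynomials below
    are the discarded parts divided by q^10.\<close>
  define w1 w2 w4 w6 where "w1 q = 1 - q - q ^ 2 + q ^ 5 + q ^ 7"
    and "w2 q = 1 - 2 * q - q^2 + 2 * q^3 + q^4 + 2 * q^5 - 2 * q^6 - 2 * q^8 - 2 * q^9"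
    and "w4 q = 1 - 4 * q + 2 * q^2 + 8 * q^3 - 5 * q^4 - 4 * q^5 - 10 * q^6 + 8 * q^7 + 9 * q^8"
    and "w6 q = 1 - 6 * q + 9 * q^2 + 10 * q^3 - 30 * q^4 + 11 * q^6 + 42 * q^7 - 70 * q^9" for q :: complex
  note w_defs = P_def X0_def w1_def w2_def w4_def w6_def
  define s2 s4 s6 s where "s2 q = 1 + 2 * q^2 + q^4"
    and "s4 q = 12 - 12 * q - 8 * q^2 - 12 * q^3 + 8 * q^5 + 4 * q^6 + 8 * q^7 + 4 * q^8"
    and "s6 q = 3 - 6 * q + 39 * q^2 + 20 * q^3 + 10 * q^4 + 4 * q^5 - 34 * q^6 - 18 * q^7"
    and "s q = - 2334 + 9594 * q - 2358 * q^2 - 28506 * q^3 + 13329 * q^4 + 27906 * q^5 + 30912 * q^6 - 38850 * q^7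
               - 80920 * q^8" for q :: complex
  have cont: "isCont P 0" "isCont w1 0" "isCont w2 0" "isCont w4 0" "isCont w6 0"
    "isCont s2 0" "isCont s4 0" "isCont s6 0" "isCont s 0"
    unfolding w_defs s2_def s4_def s6_def s_def by (intro continuous_intros)+
  have poly1: "(\<lambda>q. w1 q * w1 q - w2 q) \<in> O[at 0](\<lambda>q. q ^ 10)"
  proof -
    have "w1 q * w1 q - w2 q = q ^ 10 * s2 q" for q
      unfolding w_defs s2_def by algebra
    thus ?thesis
      using cont by (simp add: power_mult_bigo)
  qed
  have poly2: "(\<lambda>q. w2 q * w2 q - w4 q) \<in> O[at 0](\<lambda>q. q ^ 10)"
  proof -
    have "w2 q * w2 q - w4 q = q ^ 10 * s4 q" for q
      unfolding w_defs s4_def by algebra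
    thus ?thesis
      using cont by (simp add: power_mult_bigo)
  qed
  have poly3: "(\<lambda>q. w4 q * w2 q - w6 q) \<in> O[at 0](\<lambda>q. q ^ 10)"
  proof -
    have "w4 q * w2 q - w6 q = q ^ 10 * s6 q" for q
      unfolding w_defs s6_def by algebra
    thus ?thesis
      using cont by (simp add: power_mult_bigo)
  qed
  have poly4: "(\<lambda>q. P q * w6 q - X0 q) \<in> O[at 0](\<lambda>q. q ^ 10)"
  proof -
    have "P q * w6 q - X0 q = q ^ 10 * s q" for q
      unfolding w_defs s_def by algebra
    thus ?thesis
      using cont by (simp add: power_mult_bigo)
  qed
  define E where "E q = qpoch q q" for q
  have "(\<lambda>q. q ^ 10) \<in> O[at 0](\<lambda>_ :: complex. 1 :: complex)"
    by (intro isCont_bigo_1 continuous_intros)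
  note q10 = landau_o.big_trans[OF _ this]
  have bounded: "f \<in> O[at 0](\<lambda>_. 1)" if "(\<lambda>q. f q - g q) \<in> O[at 0](\<lambda>q. q ^ 10)" "isCont g 0"
    for f g :: "complex \<Rightarrow> complex"
    using sum_in_bigo(1)[OF q10[OF that(1)] isCont_bigo_1[OF that(2)]] by simp
  have trans: "(\<lambda>q. f q - h q) \<in> O[at 0](\<lambda>q. q ^ 10)"
    if "(\<lambda>q. f q - g q) \<in> O[at 0](\<lambda>q. q ^ 10)" "(\<lambda>q. g q - h q) \<in> O[at 0](\<lambda>q. q ^ 10)"
    for f g h :: "complex \<Rightarrow> complex"
    using sum_in_bigo(1)[OF that] by simp
  have E1: "(\<lambda>q. E q - w1 q) \<in> O[at 0](\<lambda>q. q ^ 10)"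
    unfolding E_def w1_def by (rule qpoch_truncate)
  have E2: "(\<lambda>q. E q * E q - w2 q) \<in> O[at 0](\<lambda>q. q ^ 10)"
    by (rule trans[OF bigo_diff_mult[OF E1 E1] poly1]) (use bounded[OF E1] cont isCont_bigo_1 in auto)
  have E4: "(\<lambda>q. E q * E q * (E q * E q) - w4 q) \<in> O[at 0](\<lambda>q. q ^ 10)"
    by (rule trans[OF bigo_diff_mult[OF E2 E2] poly2]) (use bounded[OF E2] cont isCont_bigo_1 in auto)
  have E6: "(\<lambda>q. E q * E q * (E q * E q) * (E q * E q) - w6 q) \<in> O[at 0](\<lambda>q. q ^ 10)"
    by (rule trans[OF bigo_diff_mult[OF E4 E2] poly3]) (use bounded[OF E4] cont isCont_bigo_1 in auto)
  hence E6: "(\<lambda>q. E q ^ 6 - w6 q) \<in> O[at 0](\<lambda>q. q ^ 10)"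
    by (simp add: eval_nat_numeral mult_ac)
  have "(\<lambda>q. P q * E q ^ 6 - X0 q) \<in> O[at 0](\<lambda>q. q ^ 10)"
    by (rule trans[OF bigo_diff_mult[OF _ E6] poly4]) (use cont isCont_bigo_1 in auto)
  from sum_in_bigo(2)[OF X_truncate[folded X0_def] this]
  have num: "(\<lambda>q. nome.X q - P q * E q ^ 6) \<in> O[at 0](\<lambda>q. q ^ 10)"
    by simp
  have "(\<lambda>q. inverse (E q ^ 6)) \<in> O[at 0](\<lambda>_. 1)"
  proof -
    have "(\<lambda>q. E q ^ 6 - w6 q) \<in> o[at 0](\<lambda>_. 1)"
    proof (rule landau_o.big_small_trans[OF E6])
      have "((\<lambda>q :: complex. q ^ 10) \<longlongrightarrow> 0 ^ 10) (at 0)"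
        by (intro tendsto_intros)
      thus "(\<lambda>q. q ^ 10) \<in> o[at 0](\<lambda>_ :: complex. 1 :: complex)"
        by (intro smalloI_tendsto) auto
    qed
    hence "((\<lambda>q. E q ^ 6 - w6 q) \<longlongrightarrow> 0) (at 0)"
      by (auto dest: smalloD_tendsto)
    moreover have "(w6 \<longlongrightarrow> w6 0) (at 0)"
      using cont by (simp add: isCont_def)
    ultimately have "((\<lambda>q. (E q ^ 6 - w6 q) + w6 q) \<longlongrightarrow> 0 + w6 0) (at 0)"
      by (rule tendsto_add)
    hence "((\<lambda>q. inverse (E q ^ 6)) \<longlongrightarrow> inverse 1) (at 0)"
      by (intro tendsto_inverse) (auto simp: w6_def)
    thus ?thesis
      by (intro bigoI_tendsto[where c = 1]) auto
  qed
  from landau_o.big.mult[OF num this]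
  have "(\<lambda>q. (nome.X q - P q * E q ^ 6) * inverse (E q ^ 6)) \<in> O[at 0](\<lambda>q. q ^ 10)"
    by simp
  also have "?this \<longleftrightarrow> (\<lambda>q. nome.X q / E q ^ 6 - P q) \<in> O[at 0](\<lambda>q. q ^ 10)"
  proof (rule landau_o.big.in_cong)
    show "\<forall>\<^sub>F q in at 0. (nome.X q - P q * E q ^ 6) * inverse (E q ^ 6) = nome.X q / E q ^ 6 - P q"
      using eventually_nome by eventually_elim (use nome.qpoch_q_q_nz in \<open>auto simp: E_def field_simps\<close>)
  qed
  finally show ?thesis
    by (simp add: E_def P_def)
qed

lemma filterlim_q_of: "filterlim q_of (at 0) (filtercomap Im at_top)"
proof -
  have "((\<lambda>t. exp (- (2 * pi * t))) \<longlongrightarrow> 0) at_top"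
    by (rule filterlim_compose[OF exp_at_bot])
       (auto intro!: filterlim_tendsto_pos_mult_at_top[OF tendsto_const] filterlim_ident simp: filterlim_uminus_at_bot)
  hence "((\<lambda>\<tau>. exp (- (2 * pi * Im \<tau>))) \<longlongrightarrow> 0) (filtercomap Im at_top)"
    by (rule filterlim_compose) (rule filterlim_filtercomap)
  hence "(q_of \<longlongrightarrow> 0) (filtercomap Im at_top)"
    by (subst tendsto_norm_zero_iff [symmetric]) (simp add: norm_q_of)
  thus ?thesis
    by (auto simp: filterlim_at q_of_def)
qed

text \<open>Unique existence of the expansion is asserted because \<open>constant_term\<close> is a
  definite description. The O-term is read as Im \<tau> tends to infinity, uniformly in the real
  part, which is q -> 0.\<close>

theorem proposition5p1:
  shows "(\<forall>\<tau>. Im \<tau> > 0 \<longrightarrow>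
            (\<exists>!c. laurent_expansion_on (zeta_range (q_of \<tau>)) (G_fun (q_of \<tau>)) c) \<and>
            constant_term (zeta_range (q_of \<tau>)) (G_fun (q_of \<tau>)) =
              q_powr \<tau> (1/4) / dedekind_eta \<tau> ^ 6 * G0 \<tau>
              + 9 * q_powr \<tau> (-1/12) / dedekind_eta \<tau> ^ 6 * Psi \<tau>) \<and>
         (\<lambda>\<tau>. constant_term (zeta_range (q_of \<tau>)) (G_fun (q_of \<tau>))
              - (1 + 3 * q_of \<tau> ^ 2 + 8 * q_of \<tau> ^ 3 + 21 * q_of \<tau> ^ 4 + 48 * q_of \<tau> ^ 5
                 + 116 * q_of \<tau> ^ 6 + 252 * q_of \<tau> ^ 7 + 555 * q_of \<tau> ^ 8 + 1156 * q_of \<tau> ^ 9))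
           \<in> O[filtercomap Im at_top](\<lambda>\<tau>. q_of \<tau> ^ 10)"
proof (intro conjI allI impI)
  fix \<tau> :: complex
  assume "Im \<tau> > 0"
  thus "\<exists>!c. laurent_expansion_on (zeta_range (q_of \<tau>)) (G_fun (q_of \<tau>)) c"
    by (intro nome.ex1_laurent_expansion_G nome_q_of)
  show "constant_term (zeta_range (q_of \<tau>)) (G_fun (q_of \<tau>)) =
              q_powr \<tau> (1/4) / dedekind_eta \<tau> ^ 6 * G0 \<tau>
              + 9 * q_powr \<tau> (-1/12) / dedekind_eta \<tau> ^ 6 * Psi \<tau>"
    using \<open>Im \<tau> > 0\<close> by (rule constant_term_eq)
next
  have "eventually (\<lambda>\<tau>. Im \<tau> > 0) (filtercomap Im at_top)"
    by (intro eventually_filtercomapI eventually_gt_at_top)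
  hence "\<forall>\<^sub>F \<tau> in filtercomap Im at_top. constant_term (zeta_range (q_of \<tau>)) (G_fun (q_of \<tau>)) =
           nome.X (q_of \<tau>) / qpoch (q_of \<tau>) (q_of \<tau>) ^ 6"
    by eventually_elim (intro nome.constant_term_G nome_q_of)
  hence "\<forall>\<^sub>F \<tau> in filtercomap Im at_top. constant_term (zeta_range (q_of \<tau>)) (G_fun (q_of \<tau>))
              - (1 + 3 * q_of \<tau> ^ 2 + 8 * q_of \<tau> ^ 3 + 21 * q_of \<tau> ^ 4 + 48 * q_of \<tau> ^ 5
                 + 116 * q_of \<tau> ^ 6 + 252 * q_of \<tau> ^ 7 + 555 * q_of \<tau> ^ 8 + 1156 * q_of \<tau> ^ 9) =
           nome.X (q_of \<tau>) / qpoch (q_of \<tau>) (q_of \<tau>) ^ 6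
              - (1 + 3 * q_of \<tau> ^ 2 + 8 * q_of \<tau> ^ 3 + 21 * q_of \<tau> ^ 4 + 48 * q_of \<tau> ^ 5
                 + 116 * q_of \<tau> ^ 6 + 252 * q_of \<tau> ^ 7 + 555 * q_of \<tau> ^ 8 + 1156 * q_of \<tau> ^ 9)"
    by (rule eventually_mono) (simp only:)
  from landau_o.big.in_cong[OF this]
  show "(\<lambda>\<tau>. constant_term (zeta_range (q_of \<tau>)) (G_fun (q_of \<tau>))
              - (1 + 3 * q_of \<tau> ^ 2 + 8 * q_of \<tau> ^ 3 + 21 * q_of \<tau> ^ 4 + 48 * q_of \<tau> ^ 5
                 + 116 * q_of \<tau> ^ 6 + 252 * q_of \<tau> ^ 7 + 555 * q_of \<tau> ^ 8 + 1156 * q_of \<tau> ^ 9))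
           \<in> O[filtercomap Im at_top](\<lambda>\<tau>. q_of \<tau> ^ 10)"
    using landau_o.big.compose[OF X_quotient_truncate filterlim_q_of] by blast
qed

end
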